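(* Let $1<p_0<\infty$, $\vec p=(p_1,\dots,p_n)$ with $1<p_i<\infty$, and $\frac n{p_0}<\sum_{i=1}^n\frac1{p_i}$. Suppose $f_k\in\mathcal{B}^{p_0'}_{\vec p\,'}(\mathbb{R}^n)$ ($k\in\mathbb N$) are nonnegative, $\|f_k\|_{\mathcal{B}^{p_0'}_{\vec p\,'}(\mathbb{R}^n)}\le1$ for all $k$, and $f_k\uparrow f$ almost everywhere. Then $f\in\mathcal{B}^{p_0'}_{\vec p\,'}(\mathbb{R}^n)$ and $$\lim_{k\to\infty}\|f_k\|_{\mathcal{B}^{p_0'}_{\vec p\,'}(\mathbb{R}^n)}=\|f\|_{\mathcal{B}^{p_0'}_{\vec p\,'}(\mathbb{R}^n)}.$$
   Context: $L^{\vec q}(\mathbb{R}^n)$ denotes the mixed-norm Lebesgue space with norm $\|f\|_{L^{\vec q}}=\big(\int_{\mathbb{R}}\cdots(\int_{\mathbb{R}}|f|^{q_1}dx_1)^{q_2/q_1}\cdots dx_n\big)^{1/q_n}$; $\vec p\,'=(p_1',\dots,p_n')$ with $1/p_i+1/p_i'=1$, and $p_0'$ is the conjugate of $p_0$. Cubes have sides parallel to the axes. A measurable function $b$ is a $(p_0',\vec p\,')$-block if there is a cube $Q$ with $\operatorname{supp}b\subset Q$ and $\|b\|_{L^{\vec p\,'}(\mathbb{R}^n)}\le|Q|^{\frac1{p_0}-\frac1n\sum_{i=1}^n\frac1{p_i}}$. The block space $\mathcal{B}^{p_0'}_{\vec p\,'}(\mathbb{R}^n)$ consists of measurable functions $f=\sum_{i=1}^\infty\lambda_ib_i$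 (series converging in $L^1_{\mathrm{loc}}$ and a.e.) with $\{\lambda_i\}\in\ell^1$ and each $b_i$ a $(p_0',\vec p\,')$-block, normed by $\|f\|_{\mathcal{B}^{p_0'}_{\vec p\,'}}=\inf\|\{\lambda_i\}\|_{\ell^1}$ over all such decompositions. *)

theory Defs
  imports "HOL-Analysis.Analysis"
begin

text \<open>Points of R^n are modelled as extensional functions nat => real supported on
  {..<n} (coordinate i of the paper is index i-1 here).\<close>

definition lebn :: "nat \<Rightarrow> (nat \<Rightarrow> real) measure" where
  "lebn n = completion (Pi\<^sub>M {..<n} (\<lambda>_. lborel))"

text \<open>Power of an extended nonnegative real with a positive real exponent
  (infinity to a positive power is infinity).\<close>
definition epow :: "ennreal \<Rightarrow> real \<Rightarrow> ennreal" where
  "epow x r = (if x = \<infinity> then \<infinity> else ennreal (enn2real x powr r))"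

definition conj_exp :: "real \<Rightarrow> real" where
  "conj_exp p = p / (p - 1)"

fun mixed_aux :: "nat \<Rightarrow> (nat \<Rightarrow> real) \<Rightarrow> ((nat \<Rightarrow> real) \<Rightarrow> real) \<Rightarrow> (nat \<Rightarrow> real) \<Rightarrow> ennreal" where
  "mixed_aux 0 q f x = ennreal \<bar>f x\<bar>"
| "mixed_aux (Suc k) q f x =
     epow (\<integral>\<^sup>+ t. epow (mixed_aux k q f (x(k := t))) (q k) \<partial>lborel) (1 / q k)"

definition mixed_norm :: "nat \<Rightarrow> (nat \<Rightarrow> real) \<Rightarrow> ((nat \<Rightarrow> real) \<Rightarrow> real) \<Rightarrow> ennreal" where
  "mixed_norm n q f = mixed_aux n q f (\<lambda>_. undefined)"

definition cube :: "nat \<Rightarrow> (nat \<Rightarrow> real) \<Rightarrow> real \<Rightarrow> (nat \<Rightarrow> real) set" where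
  "cube n a l = {x \<in> space (lebn n). \<forall>i<n. a i \<le> x i \<and> x i \<le> a i + l}"

definition is_block :: "nat \<Rightarrow> real \<Rightarrow> (nat \<Rightarrow> real) \<Rightarrow> ((nat \<Rightarrow> real) \<Rightarrow> real) \<Rightarrow> bool" where
  "is_block n p0 p b \<longleftrightarrow> b \<in> borel_measurable (lebn n) \<and>
     (\<exists>a l. l > 0 \<and> {x \<in> space (lebn n). b x \<noteq> 0} \<subseteq> cube n a l \<and>
        mixed_norm n (\<lambda>i. conj_exp (p i)) b
          \<le> ennreal ((l ^ n) powr (1 / p0 - (1 / real n) * (\<Sum>i<n. 1 / p i))))"

definition block_decomp :: "nat \<Rightarrow> real \<Rightarrow> (nat \<Rightarrow> real) \<Rightarrow> ((nat \<Rightarrow> real) \<Rightarrow> real)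
    \<Rightarrow> (nat \<Rightarrow> real) \<Rightarrow> (nat \<Rightarrow> (nat \<Rightarrow> real) \<Rightarrow> real) \<Rightarrow> bool" where
  "block_decomp n p0 p f lam b \<longleftrightarrow>
     summable (\<lambda>i. \<bar>lam i\<bar>) \<and> (\<forall>i. is_block n p0 p (b i)) \<and>
     (AE x in lebn n. (\<lambda>N. \<Sum>i<N. lam i * b i x) \<longlonglongrightarrow> f x) \<and>
     (\<forall>K. compact K \<and> K \<subseteq> space (lebn n) \<longrightarrow>
        (\<lambda>N. \<integral>\<^sup>+ x. ennreal \<bar>f x - (\<Sum>i<N. lam i * b i x)\<bar> * indicator K x \<partial>lebn n)
          \<longlonglongrightarrow> 0)"

definition in_block_space :: "nat \<Rightarrow> real \<Rightarrow> (nat \<Rightarrow> real) \<Rightarrow> ((nat \<Rightarrow> real) \<Rightarrow> real) \<Rightarrow> bool" where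
  "in_block_space n p0 p f \<longleftrightarrow> (\<exists>lam b. block_decomp n p0 p f lam b)"

text \<open>Block norm (infinity if f is not in the block space).\<close>
definition block_norm :: "nat \<Rightarrow> real \<Rightarrow> (nat \<Rightarrow> real) \<Rightarrow> ((nat \<Rightarrow> real) \<Rightarrow> real) \<Rightarrow> ennreal" where
  "block_norm n p0 p f =
     (INF lb \<in> {(lam, b). block_decomp n p0 p f lam b}. ennreal (\<Sum>i. \<bar>fst lb i\<bar>))"

end

theory Submission
  imports Defs
begin

text \<open>A function lies in the block space as soon as it is dominated by \<open>\<Sum>\<^sub>i g\<^sub>i\<close> with \<open>g\<^sub>i\<close>
  supported in cubes and \<open>\<Sum>\<^sub>i s\<^sub>i powr \<rho> * \<parallel>g\<^sub>i\<parallel>\<close> finite, where \<open>s\<^sub>i\<close> is the side of the \<open>i\<close>-th cube and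
  \<open>\<rho> = (\<Sum>i. 1 / p i) - n / p0 > 0\<close>; the norm is the infimum of these sums. Up to a factor
  \<open>1 + \<epsilon>\<close> the cubes may be taken from one fixed countable collection, so that block
  decompositions of different functions can be compared term by term. The families dominating
  the \<open>k\<close>-th function form decreasing convex sets in \<open>k\<close>; a Komlos-type argument selects families that
  converge almost everywhere, and their limit dominates \<open>f\<close> because cubes of extreme side carry
  uniformly little local mass. Using convergence of convex combinations instead of weak limits
  avoids duality and loses no constant in the norm.\<close>

section \<open>Powers of extended nonnegative reals\<close>

text \<open>The obstacle is that nothing links the decompositions of different members of the
  sequence: cubes, coefficients and signs are unrelated. Domination removes the signs. If
  \<open>\<bar>f\<bar> \<le> G\<close> with \<open>G = (\<Sum>i. g i)\<close> finite almost
  everywhere, then the functions \<open>f * g i / G\<close> add up to \<open>f\<close> and each is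
  bounded by \<open>g i\<close>, so only nonnegative families remain to be controlled. The
  positivity of \<open>\<rho>\<close> is what prevents escape of mass: a piece of side
  \<open>s\<close> and coefficient \<open>c\<close> has total mass at most a constant times
  \<open>c * s powr (n / p0)\<close>, and mass in a fixed box at most a constant times
  \<open>c * s powr (- \<rho>)\<close>, so neither shrinking nor growing cubes can hide anything. A
  second obstacle is measurability. Blocks are measurable for the completed measure only, while
  mixed norms are iterated integrals over sections. Borel representatives are therefore chosen
  before any Fubini argument, and comparison with the original functions goes through an almost
  everywhere monotonicity of the mixed norm.\<close>

lemma epow_top [simp]: "epow top r = top"
  by (simp add: epow_def)

lemma epow_ennreal: "0 \<le> a \<Longrightarrow> epow (ennreal a) r = ennreal (a powr r)"
  by (simp add: epow_def)

lemma epow_zero [simp]: "epow 0 r = 0"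
  by (simp add: epow_def)

lemma epow_one_right [simp]: "epow x 1 = x"
  by (cases x) (auto simp: epow_ennreal)

lemma epow_mono: "0 \<le> r \<Longrightarrow> x \<le> y \<Longrightarrow> epow x r \<le> epow y r"
  by (cases x; cases y) (auto simp: epow_ennreal top_unique intro!: ennreal_leI powr_mono2)

lemma epow_epow: "epow (epow x r) s = epow x (r * s)"
  by (cases x) (auto simp: epow_ennreal powr_powr)

lemma epow_inverse:
  assumes "0 < r" shows "epow (epow x r) (1 / r) = x" "epow (epow x (1 / r)) r = x"
  using assms by (simp_all add: epow_epow)

lemma epow_mult:
  assumes "0 < r" shows "epow (x * y) r = epow x r * epow y r"
proof (cases "x = top \<or> y = top")
  case True
  \<comment> \<open>Only \<open>z = 0\<close> needs care, since \<open>top * 0 = 0\<close> while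
    \<open>top * z = top\<close> otherwise.\<close>
  have top: "epow (top * z) r = top * epow z r" for z
    by (cases "z = 0") (use assms in \<open>auto simp: epow_def ennreal_top_mult enn2real_eq_0_iff\<close>)
  from True show ?thesis
  proof
    assume "x = top" then show ?thesis using top[of y] by simp
  next
    assume "y = top" then show ?thesis using top[of x] by (simp add: mult.commute)
  qed
next
  case False
  then obtain a b where "x = ennreal a" "y = ennreal b" "0 \<le> a" "0 \<le> b"
    by (metis ennreal_cases)
  then show ?thesis
    by (simp add: epow_ennreal powr_mult flip: ennreal_mult)
qed

lemma epow_le_iff: "0 < r \<Longrightarrow> epow x r \<le> y \<longleftrightarrow> x \<le> epow y (1 / r)"
  by (metis epow_inverse epow_mono less_imp_le zero_less_divide_1_iff)

text \<open>A positive power is an order isomorphism whose inverse is the power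
  \<open>1 / r\<close>, hence it preserves suprema.\<close>

lemma epow_SUP:
  assumes "0 < r" shows "epow (SUP i\<in>I. f i) r = (SUP i\<in>I. epow (f i) r)"
proof (rule antisym)
  show "epow (SUP i\<in>I. f i) r \<le> (SUP i\<in>I. epow (f i) r)"
    using assms by (auto simp: epow_le_iff intro!: SUP_least)
      (metis SUP_upper epow_le_iff)
  show "(SUP i\<in>I. epow (f i) r) \<le> epow (SUP i\<in>I. f i) r"
    using assms by (intro SUP_least epow_mono SUP_upper) auto
qed

lemma borel_measurable_epow [measurable (raw)]:
  "f \<in> borel_measurable M \<Longrightarrow> (\<lambda>x. epow (f x) r) \<in> borel_measurable M"
  unfolding epow_def by (intro measurable_If) (measurable, simp_all)

section \<open>The norm of $L^q$ on the line\<close>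

definition lqnorm :: "real \<Rightarrow> (real \<Rightarrow> ennreal) \<Rightarrow> ennreal" where
  "lqnorm q h = epow (\<integral>\<^sup>+ t. epow (h t) q \<partial>lborel) (1 / q)"

lemma lqnorm_mono_AE:
  assumes "0 < q" "AE t in lborel. h t \<le> k t" shows "lqnorm q h \<le> lqnorm q k"
  unfolding lqnorm_def using assms
  by (intro epow_mono nn_integral_mono_AE) (auto elim!: eventually_mono intro: epow_mono)

lemma lqnorm_le_iff: "0 < q \<Longrightarrow> lqnorm q h \<le> A \<longleftrightarrow> (\<integral>\<^sup>+ t. epow (h t) q \<partial>lborel) \<le> epow A q"
  by (simp add: lqnorm_def epow_le_iff)

lemma lqnorm_leD:
  "0 < q \<Longrightarrow> 0 \<le> a \<Longrightarrow> lqnorm q h \<le> ennreal a \<Longrightarrow> (\<integral>\<^sup>+ t. epow (h t) q \<partial>lborel) \<le> ennreal (a powr q)"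
  by (simp add: lqnorm_le_iff epow_ennreal)

lemma lqnorm_cmult:
  assumes "0 < q" "h \<in> borel_measurable lborel"
  shows "lqnorm q (\<lambda>t. c * h t) = c * lqnorm q h"
  using assms by (simp add: lqnorm_def epow_mult nn_integral_cmult epow_inverse)

lemma lqnorm_SUP:
  assumes "0 < q" "\<And>i::nat. h i \<in> borel_measurable lborel" "incseq h"
  shows "lqnorm q (\<lambda>t. SUP i. h i t) = (SUP i. lqnorm q (h i))"
proof -
  have "incseq (\<lambda>i t. epow (h i t) q)"
    using assms by (auto simp: mono_def le_fun_def intro!: epow_mono)
  then show ?thesis
    using assms by (simp add: lqnorm_def epow_SUP nn_integral_monotone_convergence_SUP)
qed

text \<open>Convexity of \<open>powr q\<close>, applied to the average of
  \<open>a / \<alpha>\<close> and \<open>b / \<beta>\<close> with weights proportional to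
  \<open>\<alpha>\<close> and \<open>\<beta>\<close>. In Minkowski's inequality
  \<open>\<alpha>\<close> and \<open>\<beta>\<close> are the two norms up to a small error, and
  integration returns \<open>(\<alpha> + \<beta>) powr q\<close>.\<close>

lemma powr_add_le:
  fixes a b \<alpha> \<beta> q :: real
  assumes q: "1 \<le> q" and pos: "0 < \<alpha>" "0 < \<beta>" and ab: "0 \<le> a" "0 \<le> b"
  shows "(a + b) powr q \<le> (\<alpha> + \<beta>) powr (q - 1) * (\<alpha> powr (1 - q) * a powr q + \<beta> powr (1 - q) * b powr q)"
proof -
  let ?s = "\<alpha> + \<beta>"
  \<comment> \<open>Serves the case where \<open>a\<close> or \<open>b\<close> vanishes: the
    coefficient of the surviving term is at least one, so the convexity step is confined to positive
    points.\<close>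
  have ge1: "1 \<le> ?s powr (q - 1) * \<gamma> powr (1 - q)" if "0 < \<gamma>" "\<gamma> \<le> ?s" for \<gamma>
  proof -
    have "1 \<le> (?s / \<gamma>) powr (q - 1)" using that q by (intro ge_one_powr_ge_zero) auto
    also have "\<dots> = ?s powr (q - 1) * \<gamma> powr (1 - q)"
      using that powr_minus[of \<gamma> "q - 1"] by (simp add: powr_divide field_simps)
    finally show ?thesis .
  qed
  show ?thesis
  proof (cases "a = 0 \<or> b = 0")
    case True
    have "a powr q \<le> ?s powr (q - 1) * \<alpha> powr (1 - q) * a powr q"
      "b powr q \<le> ?s powr (q - 1) * \<beta> powr (1 - q) * b powr q"
      using mult_right_mono[OF ge1[of \<alpha>], of "a powr q"] mult_right_mono[OF ge1[of \<beta>], of "b powr q"] pos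
      by simp_all
    with True show ?thesis
      by (auto simp: mult.assoc)
  next
    case False
    then have ab: "0 < a" "0 < b" using ab by auto
    have eq: "(\<alpha> / ?s) *\<^sub>R (a / \<alpha>) + (\<beta> / ?s) *\<^sub>R (b / \<beta>) = (a + b) / ?s"
      using pos by (simp add: add_divide_distrib)
    have "((1 - \<beta> / ?s) *\<^sub>R (a / \<alpha>) + (\<beta> / ?s) *\<^sub>R (b / \<beta>)) powr q
      \<le> (1 - \<beta> / ?s) * (a / \<alpha>) powr q + (\<beta> / ?s) * (b / \<beta>) powr q"
      using pos q ab by (intro convex_onD[OF powr_convex]) auto
    also have "1 - \<beta> / ?s = \<alpha> / ?s" using pos by (simp add: field_simps)
    finally have "((a + b) / ?s) powr q \<le> \<alpha> / ?s * (a / \<alpha>) powr q + \<beta> / ?s * (b / \<beta>) powr q"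
      unfolding eq .
    then have "?s powr q * ((a + b) / ?s) powr q
        \<le> ?s powr q * (\<alpha> / ?s * (a / \<alpha>) powr q + \<beta> / ?s * (b / \<beta>) powr q)"
      by (intro mult_left_mono) auto
    also have "?s powr q * ((a + b) / ?s) powr q = (a + b) powr q"
      using pos ab by (simp add: powr_divide)
    also have "?s powr q * (\<alpha> / ?s * (a / \<alpha>) powr q + \<beta> / ?s * (b / \<beta>) powr q)
      = ?s powr (q - 1) * (\<alpha> powr (1 - q) * a powr q + \<beta> powr (1 - q) * b powr q)"
    proof -
      have "\<alpha> powr (1 - q) = \<alpha> / \<alpha> powr q" "\<beta> powr (1 - q) = \<beta> / \<beta> powr q" "?s powr (q - 1) = ?s powr q / ?s"
        using pos by (simp_all add: powr_diff)
      then show ?thesis using pos ab by (simp add: powr_divide distrib_left)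
    qed
    finally show ?thesis .
  qed
qed

lemma lqnorm_add_le:
  assumes q: "1 \<le> q" and [measurable]: "h \<in> borel_measurable lborel" "k \<in> borel_measurable lborel"
  shows "lqnorm q (\<lambda>t. h t + k t) \<le> lqnorm q h + lqnorm q k"
proof (cases "lqnorm q h = top \<or> lqnorm q k = top")
  case False
  then obtain H K where HK: "lqnorm q h = ennreal H" "lqnorm q k = ennreal K" "0 \<le> H" "0 \<le> K"
    by (metis ennreal_cases)
  show ?thesis
  proof (rule ennreal_le_epsilon)
    fix e :: real assume e: "0 < e"
    \<comment> \<open>The padding by \<open>e / 2\<close> keeps both weights positive even when a
      norm is zero, and costs \<open>e\<close> in total.\<close>
    define \<alpha> \<beta> where "\<alpha> = H + e / 2" "\<beta> = K + e / 2"
    have pos: "0 < \<alpha>" "0 < \<beta>" using e HK by (auto simp: \<alpha>_\<beta>_def)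
    have ih: "(\<integral>\<^sup>+ t. epow (h t) q \<partial>lborel) \<le> ennreal (\<alpha> powr q)"
      "(\<integral>\<^sup>+ t. epow (k t) q \<partial>lborel) \<le> ennreal (\<beta> powr q)"
      using q HK e pos by (auto intro!: lqnorm_leD ennreal_leI simp: \<alpha>_\<beta>_def simp del: ennreal_plus)
    let ?c = "(\<alpha> + \<beta>) powr (q - 1)"
    have pt: "epow (h t + k t) q \<le> ennreal (?c * \<alpha> powr (1 - q)) * epow (h t) q
        + ennreal (?c * \<beta> powr (1 - q)) * epow (k t) q" for t
    proof (cases "h t = top \<or> k t = top")
      case True
      then show ?thesis using pos by (auto simp: ennreal_mult_top)
    next
      case False
      then obtain a b where ab: "h t = ennreal a" "k t = ennreal b" "0 \<le> a" "0 \<le> b"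
        by (metis ennreal_cases)
      then show ?thesis
        using powr_add_le[OF q pos ab(3,4)]
        by (simp add: epow_ennreal ennreal_leI algebra_simps flip: ennreal_plus ennreal_mult)
    qed
    have "(\<integral>\<^sup>+ t. epow (h t + k t) q \<partial>lborel) \<le>
        (\<integral>\<^sup>+ t. ennreal (?c * \<alpha> powr (1 - q)) * epow (h t) q
        + ennreal (?c * \<beta> powr (1 - q)) * epow (k t) q \<partial>lborel)"
      by (intro nn_integral_mono pt)
    also have "\<dots> = ennreal (?c * \<alpha> powr (1 - q)) * (\<integral>\<^sup>+ t. epow (h t) q \<partial>lborel)
        + ennreal (?c * \<beta> powr (1 - q)) * (\<integral>\<^sup>+ t. epow (k t) q \<partial>lborel)"
      by (simp add: nn_integral_add nn_integral_cmult)
    also have "\<dots> \<le> ennreal (?c * \<alpha> powr (1 - q)) * ennreal (\<alpha> powr q)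
        + ennreal (?c * \<beta> powr (1 - q)) * ennreal (\<beta> powr q)"
      by (intro add_mono mult_left_mono ih) auto
    also have "\<dots> = ennreal (?c * (\<alpha> + \<beta>))"
    proof -
      have "\<alpha> powr (1 - q) * \<alpha> powr q = \<alpha>" "\<beta> powr (1 - q) * \<beta> powr q = \<beta>"
        using pos by (simp_all flip: powr_add)
      then show ?thesis
        using pos by (simp flip: ennreal_plus ennreal_mult add: distrib_left mult.assoc)
    qed
    also have "?c * (\<alpha> + \<beta>) = (\<alpha> + \<beta>) powr q"
      using pos powr_add[of "\<alpha> + \<beta>" "q - 1" 1] by simp
    finally have "lqnorm q (\<lambda>t. h t + k t) \<le> ennreal (\<alpha> + \<beta>)"
      using q pos by (subst lqnorm_le_iff) (auto simp: epow_ennreal simp del: ennreal_plus)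
    also have "ennreal (\<alpha> + \<beta>) = lqnorm q h + lqnorm q k + ennreal e"
      using e HK by (simp add: \<alpha>_\<beta>_def flip: ennreal_plus)
    finally show "lqnorm q (\<lambda>t. h t + k t) \<le> lqnorm q h + lqnorm q k + ennreal e" .
  qed
qed auto

text \<open>Hoelder's inequality with a crude constant: split the integral at the level
  \<open>H * l powr (- 1 / q)\<close>, where \<open>H\<close> is the norm.\<close>
lemma nn_integral_le_lqnorm:
  assumes q: "1 < q" and l: "0 < l" and [measurable]: "h \<in> borel_measurable lborel"
    and zero: "\<And>t. t \<notin> {c..c + l} \<Longrightarrow> h t = 0"
  shows "(\<integral>\<^sup>+ t. h t \<partial>lborel) \<le> ennreal (2 * l powr (1 - 1 / q)) * lqnorm q h"
proof (cases "lqnorm q h")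
  case top
  then show ?thesis using l by (simp add: ennreal_mult_top)
next
  case (real H)
  let ?C = "2 * l powr (1 - 1 / q)"
  show ?thesis
  proof (rule ennreal_le_epsilon)
    fix e :: real assume e: "0 < e"
    \<comment> \<open>The slack is scaled so that the final bound \<open>?C * H'\<close> exceeds
      \<open>?C * H\<close> by exactly \<open>e\<close>; it also makes the level \<open>T\<close>
      positive when the norm is zero.\<close>
    define H' where "H' = H + e / ?C"
    have H': "0 < H'" using l e real by (auto simp: H'_def add_nonneg_pos)
    define T where "T = H' * l powr (- 1 / q)"
    have T: "0 < T" using H' l by (simp add: T_def)
    have ih: "(\<integral>\<^sup>+ t. epow (h t) q \<partial>lborel) \<le> ennreal (H' powr q)"
      using q real l e H' by (auto intro!: lqnorm_leD ennreal_leI simp: H'_def simp del: ennreal_plus)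
    \<comment> \<open>Values up to \<open>T\<close> are paid for by the indicator. Above
      \<open>T\<close>, the factor \<open>a powr (1 - q)\<close> is at most
      \<open>T powr (1 - q)\<close> because \<open>1 - q\<close> is negative.\<close>
    have pt: "h t \<le> ennreal T * indicator {c..c + l} t + ennreal (T powr (1 - q)) * epow (h t) q" for t
    proof (cases "t \<in> {c..c + l}")
      case True
      show ?thesis
      proof (cases "h t")
        case top
        then show ?thesis using T by (simp add: ennreal_mult_top)
      next
        case (real a)
        have "a \<le> T + T powr (1 - q) * a powr q"
        proof (cases "a \<le> T")
          case False
          then have "a = a powr (1 - q) * a powr q"
            using T by (simp flip: powr_add)
          also have "\<dots> \<le> T powr (1 - q) * a powr q"
            using q T False by (intro mult_right_mono powr_mono2') auto
          finally show ?thesis using T by linarith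
        qed (simp add: add_increasing2)
        then show ?thesis using True real T
          by (simp add: epow_ennreal ennreal_leI flip: ennreal_plus ennreal_mult)
      qed
    qed (simp add: zero)
    have "(\<integral>\<^sup>+ t. h t \<partial>lborel) \<le>
      (\<integral>\<^sup>+ t. ennreal T * indicator {c..c + l} t + ennreal (T powr (1 - q)) * epow (h t) q \<partial>lborel)"
      by (intro nn_integral_mono pt)
    also have "\<dots> = ennreal T * ennreal l + ennreal (T powr (1 - q)) * (\<integral>\<^sup>+ t. epow (h t) q \<partial>lborel)"
      using l by (simp add: nn_integral_add nn_integral_cmult)
    also have "\<dots> \<le> ennreal T * ennreal l + ennreal (T powr (1 - q)) * ennreal (H' powr q)"
      by (intro add_mono mult_left_mono ih) auto
    also have "\<dots> = ennreal (T * l + T powr (1 - q) * H' powr q)"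
      using l T by (simp flip: ennreal_plus ennreal_mult)
    also have "T * l = H' * l powr (1 - 1 / q)"
      using l powr_add[of l "- 1 / q" 1] by (simp add: T_def)
    also have "T powr (1 - q) * H' powr q = (H' powr (1 - q) * H' powr q) * l powr (1 - 1 / q)"
    proof -
      have "(- 1 / q) * (1 - q) = 1 - 1 / q" using q by (simp add: field_simps)
      then have "(l powr (- 1 / q)) powr (1 - q) = l powr (1 - 1 / q)" by (simp only: powr_powr)
      then show ?thesis using H' l by (simp add: T_def powr_mult)
    qed
    also have "H' powr (1 - q) * H' powr q = H'"
      using H' by (simp flip: powr_add)
    also have "H' * l powr (1 - 1 / q) + H' * l powr (1 - 1 / q) = ?C * H + e"
      using l by (simp add: H'_def distrib_left distrib_right)
    also have "ennreal (?C * H + e) = ennreal ?C * lqnorm q h + ennreal e"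
      using real e by (simp add: ennreal_mult)
    finally show "(\<integral>\<^sup>+ t. h t \<partial>lborel) \<le> ennreal ?C * lqnorm q h + ennreal e" .
  qed
qed

section \<open>Mixed norms of extended nonnegative functions\<close>

abbreviation leb :: "nat set \<Rightarrow> (nat \<Rightarrow> real) measure" where
  "leb I \<equiv> Pi\<^sub>M I (\<lambda>_. lborel)"

interpretation leb: product_sigma_finite "\<lambda>_::nat. lborel :: real measure"
  by standard

lemma sigma_finite_leb: "finite I \<Longrightarrow> sigma_finite_measure (leb I)"
  by (rule leb.sigma_finite)

lemma space_leb: "space (leb I) = PiE I (\<lambda>_. UNIV)"
  by (simp add: space_PiM)

lemma fun_upd_space_leb:
  "k < n \<Longrightarrow> x \<in> space (leb {Suc k..<n}) \<Longrightarrow> x(k := t) \<in> space (leb {k..<n})"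
  by (auto simp: space_leb PiE_def extensional_def)

lemma insert_atLeast_Suc: "k < n \<Longrightarrow> insert k {Suc k..<n} = {k..<n}"
  by auto

text \<open>Fubini for null sets. The set where \<open>P\<close> fails may be nonmeasurable, so the
  argument runs on a measurable null set containing it.\<close>

lemma AE_leb_insert:
  assumes I: "finite I" "k \<notin> I" and AE: "AE x in leb (insert k I). P x"
  shows "AE x in leb I. AE t in lborel. P (x(k := t))"
proof -
  obtain N where N: "N \<in> sets (leb (insert k I))" "emeasure (leb (insert k I)) N = 0"
    and P: "{x \<in> space (leb (insert k I)). \<not> P x} \<subseteq> N"
    using AE by (auto elim: AE_E)
  have upd: "(\<lambda>(x, t). x(k := t)) \<in> leb I \<Otimes>\<^sub>M lborel \<rightarrow>\<^sub>M leb (insert k I)"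
    by (rule measurable_add_dim)
  have ind: "indicator N \<in> borel_measurable (leb (insert k I))"
    using N(1) by (rule borel_measurable_indicator)
  have m: "(\<lambda>z. indicator N ((fst z)(k := snd z)) :: ennreal) \<in> borel_measurable (leb I \<Otimes>\<^sub>M lborel)"
    using measurable_compose[OF upd ind] by (simp add: split_beta')
  have "(\<integral>\<^sup>+ x. (\<integral>\<^sup>+ t. indicator N (x(k := t)) \<partial>lborel) \<partial>leb I) = (0 :: ennreal)"
    using N I ind leb.product_nn_integral_insert[of I k "indicator N"] by simp
  then have "AE x in leb I. (\<integral>\<^sup>+ t. indicator N (x(k := t)) \<partial>lborel) = (0 :: ennreal)"
    using m by (subst (asm) nn_integral_0_iff_AE) (auto intro!: lborel.borel_measurable_nn_integral simp: split_beta')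
  with AE_space show ?thesis
  proof eventually_elim
    case (elim x)
    have "(\<lambda>t. indicator N (x(k := t)) :: ennreal) \<in> borel_measurable lborel"
      using measurable_compose[OF measurable_Pair1'[OF \<open>x \<in> space (leb I)\<close>] m] by simp
    with elim have "AE t in lborel. indicator N (x(k := t)) = (0 :: ennreal)"
      by (subst (asm) nn_integral_0_iff_AE) auto
    then show ?case
    proof eventually_elim
      case (elim t)
      have "x(k := t) \<in> space (leb (insert k I))"
        using \<open>x \<in> space (leb I)\<close> by (auto simp: space_leb PiE_def extensional_def)
      with elim P show ?case by (auto simp: indicator_def split: if_splits)
    qed
  qed
qed

text \<open>Coordinates are integrated out from the lowest one upwards, so \<open>emix k q g\<close>
  is regarded as a function on \<open>leb {k..<n}\<close>, and all inductions on \<open>k\<close>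
  below take place on these shrinking products.\<close>

fun emix :: "nat \<Rightarrow> (nat \<Rightarrow> real) \<Rightarrow> ((nat \<Rightarrow> real) \<Rightarrow> ennreal) \<Rightarrow> (nat \<Rightarrow> real) \<Rightarrow> ennreal" where
  "emix 0 q g x = g x"
| "emix (Suc k) q g x = lqnorm (q k) (\<lambda>t. emix k q g (x(k := t)))"

lemma mixed_aux_eq_emix: "mixed_aux k q f x = emix k q (\<lambda>x. ennreal \<bar>f x\<bar>) x"
  by (induction k arbitrary: x) (simp_all add: lqnorm_def)

lemma borel_measurable_emix:
  assumes "g \<in> borel_measurable (leb {..<n})" "k \<le> n"
  shows "emix k q g \<in> borel_measurable (leb {k..<n})"
  using assms(2)
proof (induction k)
  case 0
  then show ?case using assms(1) by (simp add: lessThan_atLeast0)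
next
  case (Suc k)
  have [measurable]: "emix k q g \<in> borel_measurable (leb (insert k {Suc k..<n}))"
    using Suc by (simp add: insert_atLeast_Suc)
  have [measurable]: "(\<lambda>z. emix k q g ((fst z)(k := snd z))) \<in> borel_measurable (leb {Suc k..<n} \<Otimes>\<^sub>M lborel)"
    using measurable_compose[OF measurable_add_dim \<open>emix k q g \<in> _\<close>] by (simp add: split_beta')
  show ?case
    unfolding emix.simps lqnorm_def
    by (intro borel_measurable_epow lborel.borel_measurable_nn_integral) (simp add: split_beta')
qed

lemma borel_measurable_emix_section:
  assumes "g \<in> borel_measurable (leb {..<n})" "k < n" "x \<in> space (leb {Suc k..<n})"
  shows "(\<lambda>t. emix k q g (x(k := t))) \<in> borel_measurable lborel"
proof -
  have "(\<lambda>t. x(k := t)) \<in> lborel \<rightarrow>\<^sub>M leb {k..<n}"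
    using assms by (intro measurable_fun_upd[where J = "{Suc k..<n}"]) auto
  from measurable_compose[OF this borel_measurable_emix] assms show ?thesis
    by simp
qed

lemma emix_mono_AE:
  assumes q: "\<And>i. i < n \<Longrightarrow> 0 < q i" and gh: "AE x in leb {..<n}. g x \<le> h x" and "k \<le> n"
  shows "AE x in leb {k..<n}. emix k q g x \<le> emix k q h x"
  using \<open>k \<le> n\<close>
proof (induction k)
  case 0
  then show ?case using gh by (simp only: emix.simps lessThan_atLeast0)
next
  case (Suc k)
  then have "AE x in leb (insert k {Suc k..<n}). emix k q g x \<le> emix k q h x"
    by (subst insert_atLeast_Suc) auto
  from AE_leb_insert[OF _ _ this] show ?case
    using Suc.prems q[of k] by (auto elim!: eventually_mono intro: lqnorm_mono_AE)
qed

lemma emix_add_le: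
  assumes q: "\<And>i. i < n \<Longrightarrow> 1 \<le> q i"
    and g: "g \<in> borel_measurable (leb {..<n})" and h: "h \<in> borel_measurable (leb {..<n})"
  shows "k \<le> n \<Longrightarrow> x \<in> space (leb {k..<n}) \<Longrightarrow>
    emix k q (\<lambda>x. g x + h x) x \<le> emix k q g x + emix k q h x"
proof (induction k arbitrary: x)
  case (Suc k)
  have "emix (Suc k) q (\<lambda>x. g x + h x) x
      \<le> lqnorm (q k) (\<lambda>t. emix k q g (x(k := t)) + emix k q h (x(k := t)))"
    unfolding emix.simps using Suc q[of k]
    by (intro lqnorm_mono_AE AE_I2 Suc.IH fun_upd_space_leb) auto
  also have "\<dots> \<le> emix (Suc k) q g x + emix (Suc k) q h x"
    unfolding emix.simps using Suc.prems q[of k] g h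
    by (intro lqnorm_add_le borel_measurable_emix_section[where n = n]) auto
  finally show ?case .
qed simp

lemma emix_cmult:
  assumes q: "\<And>i. i < n \<Longrightarrow> 0 < q i" and g: "g \<in> borel_measurable (leb {..<n})"
  shows "k \<le> n \<Longrightarrow> x \<in> space (leb {k..<n}) \<Longrightarrow> emix k q (\<lambda>x. c * g x) x = c * emix k q g x"
proof (induction k arbitrary: x)
  case (Suc k)
  then show ?case
    using q[of k] borel_measurable_emix_section[OF g, of k x]
    by (simp add: fun_upd_space_leb lqnorm_cmult)
qed simp

lemma emix_mono:
  assumes q: "\<And>i. i < n \<Longrightarrow> 0 < q i" and gh: "\<And>x. x \<in> space (leb {..<n}) \<Longrightarrow> g x \<le> h x"
  shows "k \<le> n \<Longrightarrow> x \<in> space (leb {k..<n}) \<Longrightarrow> emix k q g x \<le> emix k q h x"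
proof (induction k arbitrary: x)
  case (Suc k)
  then show ?case
    using q[of k] by (auto intro!: lqnorm_mono_AE AE_I2 Suc.IH fun_upd_space_leb)
qed (simp add: gh lessThan_atLeast0)

lemma emix_SUP:
  assumes q: "\<And>i. i < n \<Longrightarrow> 0 < q i" and g: "\<And>i::nat. g i \<in> borel_measurable (leb {..<n})"
    and inc: "\<And>x. x \<in> space (leb {..<n}) \<Longrightarrow> incseq (\<lambda>i. g i x)"
  shows "k \<le> n \<Longrightarrow> x \<in> space (leb {k..<n}) \<Longrightarrow>
    emix k q (\<lambda>x. SUP i. g i x) x = (SUP i. emix k q (g i) x)"
proof (induction k arbitrary: x)
  case (Suc k)
  have "emix (Suc k) q (\<lambda>x. SUP i. g i x) x = lqnorm (q k) (\<lambda>t. SUP i. emix k q (g i) (x(k := t)))"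
    using Suc by (simp add: fun_upd_space_leb)
  also have "\<dots> = (SUP i. emix (Suc k) q (g i) x)"
    unfolding emix.simps
  proof (rule lqnorm_SUP)
    show "incseq (\<lambda>i t. emix k q (g i) (x(k := t)))"
      using Suc.prems inc q
      by (auto simp: mono_def le_fun_def intro!: emix_mono[where n = n] fun_upd_space_leb)
  qed (use Suc.prems q[of k] g borel_measurable_emix_section[of _ n k x] in auto)
  finally show ?case .
qed simp

text \<open>Lets Hoelder's inequality on the line be applied in each coordinate: a partial norm
  still vanishes off the sides that are not yet integrated.\<close>

lemma emix_eq_0_off:
  assumes q: "\<And>i. i < n \<Longrightarrow> 0 < q i"
    and g: "\<And>x. x \<in> space (leb {..<n}) \<Longrightarrow> \<exists>i<n. x i \<notin> J i \<Longrightarrow> g x = 0"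
  shows "k \<le> n \<Longrightarrow> x \<in> space (leb {k..<n}) \<Longrightarrow> i \<in> {k..<n} \<Longrightarrow> x i \<notin> J i \<Longrightarrow> emix k q g x = 0"
proof (induction k arbitrary: x)
  case 0
  then show ?case by (auto simp: lessThan_atLeast0 intro!: g)
next
  case (Suc k)
  then have "emix k q g (x(k := t)) = 0" for t
    by (intro Suc.IH fun_upd_space_leb) auto
  then show ?case by (simp add: lqnorm_def)
qed

text \<open>Hoelder's inequality one coordinate at a time. With all exponents equal to 1 the left
  side is an iterated integral; coordinate \<open>i\<close> contributes the factor
  \<open>2 * l powr (1 - 1 / q i)\<close>.\<close>

lemma emix_one_le:
  assumes q: "\<And>i. i < n \<Longrightarrow> 1 < q i" and l: "0 < l" and gm: "g \<in> borel_measurable (leb {..<n})"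
    and g: "\<And>x. x \<in> space (leb {..<n}) \<Longrightarrow> \<exists>i<n. x i \<notin> {a i..a i + l} \<Longrightarrow> g x = 0"
  shows "k \<le> n \<Longrightarrow> x \<in> space (leb {k..<n}) \<Longrightarrow>
    emix k (\<lambda>_. 1) g x \<le> ennreal (2 ^ k * l powr (\<Sum>i<k. 1 - 1 / q i)) * emix k q g x"
proof (induction k arbitrary: x)
  case 0
  then show ?case using l by simp
next
  case (Suc k)
  let ?C = "2 ^ k * l powr (\<Sum>i<k. 1 - 1 / q i)"
  have q0: "\<And>i. i < n \<Longrightarrow> 0 < q i" using q by force
  have m: "(\<lambda>t. emix k q g (x(k := t))) \<in> borel_measurable lborel"
    using Suc.prems gm by (intro borel_measurable_emix_section[where n = n]) auto
  have "emix (Suc k) (\<lambda>_. 1) g x \<le> (\<integral>\<^sup>+ t. ennreal ?C * emix k q g (x(k := t)) \<partial>lborel)"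
    using Suc.prems by (auto simp: lqnorm_def intro!: nn_integral_mono Suc.IH fun_upd_space_leb)
  also have "\<dots> = ennreal ?C * (\<integral>\<^sup>+ t. emix k q g (x(k := t)) \<partial>lborel)"
    using m by (intro nn_integral_cmult)
  also have "\<dots> \<le> ennreal ?C * (ennreal (2 * l powr (1 - 1 / q k)) * lqnorm (q k) (\<lambda>t. emix k q g (x(k := t))))"
  proof (rule mult_left_mono[OF nn_integral_le_lqnorm[OF _ l m]])
    show "emix k q g (x(k := t)) = 0" if "t \<notin> {a k..a k + l}" for t
      using Suc.prems that
      by (intro emix_eq_0_off[where n = n and i = k and J = "\<lambda>i. {a i..a i + l}"] fun_upd_space_leb)
        (use q0 g in \<open>force+\<close>)
  qed (use Suc.prems q in auto)
  also have "\<dots> = ennreal (?C * (2 * l powr (1 - 1 / q k))) * emix (Suc k) q g x"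
    by (simp add: ennreal_mult mult.assoc)
  also have "?C * (2 * l powr (1 - 1 / q k)) = 2 ^ Suc k * l powr (\<Sum>i<Suc k. 1 - 1 / q i)"
    by (simp add: powr_add)
  finally show ?case .
qed

lemma nn_integral_leb_eq_emix:
  assumes g: "g \<in> borel_measurable (leb {..<n})"
  shows "k \<le> n \<Longrightarrow> (\<integral>\<^sup>+ x. g x \<partial>leb {..<n}) = (\<integral>\<^sup>+ x. emix k (\<lambda>_. 1) g x \<partial>leb {k..<n})"
proof (induction k)
  case 0
  then show ?case by (simp add: lessThan_atLeast0)
next
  case (Suc k)
  have "emix k (\<lambda>_. 1) g \<in> borel_measurable (leb (insert k {Suc k..<n}))"
    using borel_measurable_emix[OF g, of k] Suc.prems by (simp add: insert_atLeast_Suc)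
  from leb.product_nn_integral_insert[OF _ _ this] Suc show ?case
    by (simp add: insert_atLeast_Suc lqnorm_def)
qed

text \<open>The base point is the only point of \<open>leb {n..<n}\<close>; updating its first
  \<open>n\<close> coordinates yields exactly the extensional points of
  \<open>leb {..<n}\<close>.\<close>

definition mnorm :: "nat \<Rightarrow> (nat \<Rightarrow> real) \<Rightarrow> ((nat \<Rightarrow> real) \<Rightarrow> ennreal) \<Rightarrow> ennreal" where
  "mnorm n q g = emix n q g (\<lambda>_. undefined)"

lemma undefined_space_leb [simp]: "(\<lambda>_. undefined) \<in> space (leb {n..<n})"
  by (simp add: space_leb)

lemma mixed_norm_eq_mnorm: "mixed_norm n q f = mnorm n q (\<lambda>x. ennreal \<bar>f x\<bar>)"
  by (simp add: mixed_norm_def mnorm_def mixed_aux_eq_emix)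

text \<open>No measurability is assumed here: the sections of a block need not be Borel measurable.\<close>
lemma mnorm_mono_AE:
  assumes "\<And>i. i < n \<Longrightarrow> 0 < q i" "AE x in leb {..<n}. g x \<le> h x"
  shows "mnorm n q g \<le> mnorm n q h"
proof -
  have "AE x in leb {}. emix n q g x \<le> emix n q h x"
    using emix_mono_AE[of n q g h n] assms by (subst atLeastLessThan_empty[of n n, symmetric]) auto
  \<comment> \<open>The empty product is counting measure on one point, so a statement that holds
    almost everywhere there holds at that point.\<close>
  then show ?thesis
    by (subst (asm) PiM_empty) (simp add: mnorm_def AE_count_space)
qed

lemma mnorm_add_le:
  assumes "\<And>i. i < n \<Longrightarrow> 1 \<le> q i" "g \<in> borel_measurable (leb {..<n})" "h \<in> borel_measurable (leb {..<n})"
  shows "mnorm n q (\<lambda>x. g x + h x) \<le> mnorm n q g + mnorm n q h"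
  unfolding mnorm_def using assms by (intro emix_add_le[where n = n]) auto

lemma mnorm_cmult:
  assumes "\<And>i. i < n \<Longrightarrow> 0 < q i" "g \<in> borel_measurable (leb {..<n})"
  shows "mnorm n q (\<lambda>x. c * g x) = c * mnorm n q g"
  unfolding mnorm_def using assms by (intro emix_cmult[where n = n]) auto

lemma mnorm_SUP:
  assumes "\<And>i. i < n \<Longrightarrow> 0 < q i" "\<And>i::nat. g i \<in> borel_measurable (leb {..<n})"
    "\<And>x. incseq (\<lambda>i. g i x)"
  shows "mnorm n q (\<lambda>x. SUP i. g i x) = (SUP i. mnorm n q (g i))"
  unfolding mnorm_def using assms by (intro emix_SUP[where n = n]) auto

lemma mnorm_liminf_le:
  assumes q: "\<And>i. i < n \<Longrightarrow> 0 < q i" and g: "\<And>i::nat. g i \<in> borel_measurable (leb {..<n})"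
  shows "mnorm n q (\<lambda>x. liminf (\<lambda>i. g i x)) \<le> liminf (\<lambda>i. mnorm n q (g i))"
proof -
  have "mnorm n q (\<lambda>x. liminf (\<lambda>i. g i x)) = (SUP m. mnorm n q (\<lambda>x. INF i\<in>{m..}. g i x))"
    unfolding liminf_SUP_INF
    by (rule mnorm_SUP) (use q g in \<open>auto intro!: borel_measurable_INF INF_superset_mono monoI\<close>)
  also have "\<dots> \<le> (SUP m. INF i\<in>{m..}. mnorm n q (g i))"
    by (intro SUP_mono' INF_greatest mnorm_mono_AE) (auto intro: q INF_lower)
  finally show ?thesis unfolding liminf_SUP_INF .
qed

text \<open>Several blocks, possibly infinitely many, may be assigned to the same cube; this bounds
  the single function into which they are merged.\<close>

lemma mnorm_suminf_le:
  assumes q: "\<And>i. i < n \<Longrightarrow> 1 \<le> q i" and g: "\<And>i::nat. g i \<in> borel_measurable (leb {..<n})"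
  shows "mnorm n q (\<lambda>x. \<Sum>i. g i x) \<le> (\<Sum>i. mnorm n q (g i))"
proof -
  have q0: "0 < q i" if "i < n" for i using q[OF that] by simp
  have fin: "mnorm n q (\<lambda>x. \<Sum>i<N. g i x) \<le> (\<Sum>i<N. mnorm n q (g i))" for N
  proof (induction N)
    case 0
    show ?case using mnorm_cmult[of n q "\<lambda>_. 0" 0] q0 by simp
  next
    case (Suc N)
    have "mnorm n q (\<lambda>x. \<Sum>i<Suc N. g i x) \<le> mnorm n q (\<lambda>x. \<Sum>i<N. g i x) + mnorm n q (g N)"
      using mnorm_add_le[OF q, where g = "\<lambda>x. \<Sum>i<N. g i x" and h = "g N"] g by simp
    with Suc show ?case by (auto intro: order_trans add_right_mono)
  qed
  have "mnorm n q (\<lambda>x. \<Sum>i. g i x) = (SUP N. mnorm n q (\<lambda>x. \<Sum>i<N. g i x))"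
    unfolding suminf_eq_SUP
    by (rule mnorm_SUP) (use q0 g in \<open>auto intro!: monoI sum_mono2\<close>)
  also have "\<dots> \<le> (SUP N. \<Sum>i<N. mnorm n q (g i))"
    by (intro SUP_mono' fin)
  finally show ?thesis by (simp add: suminf_eq_SUP)
qed

lemma nn_integral_le_mnorm:
  assumes "\<And>i. i < n \<Longrightarrow> 1 < q i" "0 < l" "g \<in> borel_measurable (leb {..<n})"
    "\<And>x. x \<in> space (leb {..<n}) \<Longrightarrow> \<exists>i<n. x i \<notin> {a i..a i + l} \<Longrightarrow> g x = 0"
  shows "(\<integral>\<^sup>+ x. g x \<partial>leb {..<n}) \<le> ennreal (2 ^ n * l powr (\<Sum>i<n. 1 - 1 / q i)) * mnorm n q g"
proof -
  have "(\<integral>\<^sup>+ x. g x \<partial>leb {..<n}) = emix n (\<lambda>_. 1) g (\<lambda>_. undefined)"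
    using nn_integral_leb_eq_emix[OF assms(3), of n] by (simp add: leb.nn_integral_empty)
  then show ?thesis
    using emix_one_le[where q = q and n = n and l = l and a = a and k = n and x = "\<lambda>_. undefined"] assms
    by (simp add: mnorm_def)
qed

section \<open>A compactness principle of Komlos type\<close>

text \<open>The decreasing bijection \<open>exp (- x)\<close> from the extended half-line onto the
  unit interval, with \<open>top\<close> sent to 0. Every measurable function thus acquires a
  bounded image, which is square integrable for a finite measure.\<close>

definition eexp :: "ennreal \<Rightarrow> real" where
  "eexp x = (if x = top then 0 else exp (- enn2real x))"

lemma eexp_bounds: "0 \<le> eexp x" "eexp x \<le> 1"
  by (auto simp: eexp_def)

lemma borel_measurable_eexp [measurable (raw)]:
  "g \<in> borel_measurable M \<Longrightarrow> (\<lambda>x. eexp (g x)) \<in> borel_measurable M"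
  unfolding eexp_def by (intro measurable_If) (measurable, simp_all)

lemma eexp_midpoint: "(eexp ((x + y) / 2))\<^sup>2 = eexp x * eexp y"
proof (cases "x = top \<or> y = top")
  case True
  then show ?thesis by (auto simp: eexp_def ennreal_divide_top ennreal_top_divide)
next
  case False
  then obtain a b where ab: "x = ennreal a" "y = ennreal b" "0 \<le> a" "0 \<le> b"
    by (metis ennreal_cases)
  then have "(x + y) / 2 = ennreal ((a + b) / 2)"
    by (simp add: divide_ennreal flip: ennreal_plus ennreal_numeral)
  with ab show ?thesis
    by (simp add: eexp_def power2_eq_square flip: exp_add)
qed

text \<open>The inverse of \<open>eexp\<close> is the continuous function \<open>- ln\<close> away
  from 0, and a limit 0 corresponds to divergence to \<open>top\<close>.\<close>

lemma convergent_if_eexp_convergent: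
  assumes u: "(\<lambda>m. eexp (g m)) \<longlonglongrightarrow> u"
  shows "\<exists>L. g \<longlonglongrightarrow> L"
proof (cases "u = 0")
  case True
  have "g \<longlonglongrightarrow> top"
    unfolding tendsto_top_iff_ennreal
  proof (intro allI impI)
    fix l :: real assume "0 \<le> l"
    have "eventually (\<lambda>m. eexp (g m) < exp (- l)) sequentially"
      using u True by (intro order_tendstoD) auto
    then show "eventually (\<lambda>m. ennreal l < g m) sequentially"
    proof eventually_elim
      case (elim m)
      then show ?case using \<open>0 \<le> l\<close>
        by (cases "g m") (auto simp: eexp_def ennreal_less_iff)
    qed
  qed
  then show ?thesis ..
next
  case False
  with LIMSEQ_le_const[OF u] eexp_bounds(1) have "0 < u" by (metis less_eq_real_def)
  have "eventually (\<lambda>m. 0 < eexp (g m)) sequentially"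
    using u \<open>0 < u\<close> by (intro order_tendstoD)
  then have "eventually (\<lambda>m. ennreal (- ln (eexp (g m))) = g m) sequentially"
    by eventually_elim (auto simp: eexp_def less_top split: if_splits)
  moreover have "(\<lambda>m. ennreal (- ln (eexp (g m)))) \<longlonglongrightarrow> ennreal (- ln u)"
    using u \<open>0 < u\<close> by (intro tendsto_intros) auto
  ultimately show ?thesis by (blast intro: Lim_transform_eventually)
qed

text \<open>Near-minimizers of the functional \<open>\<integral> (eexp \<circ> g)\<^sup>2\<close> form a Cauchy sequence in \<open>L\<^sup>2\<close>
  by the parallelogram law, since the midpoint of \<open>g\<close> and \<open>h\<close> corresponds to the geometric mean
  of \<open>eexp \<circ> g\<close> and \<open>eexp \<circ> h\<close>.\<close>
lemma midpoint_closed_AE_convergent: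
  fixes C :: "nat \<Rightarrow> ('a \<Rightarrow> ennreal) set"
  assumes M: "sigma_finite_measure M"
    and ne: "\<And>m. C m \<noteq> {}" and dec: "\<And>m k. m \<le> k \<Longrightarrow> C k \<subseteq> C m"
    and meas: "\<And>m g. g \<in> C m \<Longrightarrow> g \<in> borel_measurable M"
    and mid: "\<And>m g h. g \<in> C m \<Longrightarrow> h \<in> C m \<Longrightarrow> (\<lambda>x. (g x + h x) / 2) \<in> C m"
  shows "\<exists>g. (\<forall>m. g m \<in> C m) \<and> (AE x in M. \<exists>L. (\<lambda>m. g m x) \<longlonglongrightarrow> L)"
proof -
  \<comment> \<open>Weighting by a positive integrable \<open>w\<close> gives a finite measure with
    the same null sets.\<close>
  obtain w where w [measurable]: "w \<in> borel_measurable M" and wf: "integral\<^sup>N M w \<noteq> \<infinity>"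
    and wpos: "\<And>x. x \<in> space M \<Longrightarrow> 0 < w x"
    using sigma_finite_measure.Ex_finite_integrable_function[OF M] by blast
  define M' where "M' = density M w"
  have sets [measurable_cong, simp]: "sets M' = sets M" by (simp add: M'_def)
  have "emeasure M' (space M') = integral\<^sup>N M w"
    by (auto simp: M'_def emeasure_density intro!: nn_integral_cong)
  then interpret M': finite_measure M'
    using wf by (intro finite_measureI) auto
  define \<Phi> where "\<Phi> g = (\<integral>x. (eexp (g x))\<^sup>2 \<partial>M')" for g
  have m' [measurable]: "g \<in> borel_measurable M'" if "g \<in> C m" for g m
    using meas[OF that] by simp
  have int: "integrable M' (\<lambda>x. eexp (g x) * eexp (h x))" if "g \<in> C m" "h \<in> C k" for g h m k
    using m'[OF that(1)] m'[OF that(2)]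
    by (intro M'.integrable_const_bound[where B = 1] AE_I2) (auto intro!: mult_le_one simp: eexp_bounds)
  have \<Phi>0: "0 \<le> \<Phi> g" for g by (simp add: \<Phi>_def)
  have \<Phi>1: "\<Phi> g \<le> measure M' (space M')" if "g \<in> C m" for g m
  proof -
    have "\<Phi> g \<le> (\<integral>x. 1 \<partial>M')"
      unfolding \<Phi>_def power2_eq_square
      by (intro integral_mono int[OF that that] mult_le_one eexp_bounds) simp
    then show ?thesis by simp
  qed
  define s where "s m = (INF g\<in>C m. \<Phi> g)" for m
  have bdd: "bdd_below (\<Phi> ` C m)" for m using \<Phi>0 by (auto intro!: bdd_belowI)
  have s_le: "s m \<le> \<Phi> g" if "g \<in> C m" for g m
    unfolding s_def using bdd that by (intro cINF_lower)
  have "incseq s"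
    unfolding s_def using ne dec bdd by (intro monoI cINF_superset_mono) auto
  moreover have "s m \<le> measure M' (space M')" for m
    using ne[of m] s_le \<Phi>1 by (metis all_not_in_conv order_trans)
  ultimately obtain S where S: "s \<longlonglongrightarrow> S" "\<And>m. s m \<le> S"
    by (metis incseq_convergent)
  have "\<exists>m\<ge>j. S - (1/8) ^ j < s m" for j
  proof -
    have "eventually (\<lambda>m. S - (1/8) ^ j < s m) sequentially"
      using S by (intro order_tendstoD[OF S(1)]) simp
    from eventually_conj[OF this eventually_ge_at_top[of j]] show ?thesis
      by (auto dest!: eventually_happens)
  qed
  then obtain r where r: "\<And>j. j \<le> r j" "\<And>j. S - (1/8) ^ j < s (r j)" by metis
  have "\<exists>g\<in>C (r j). \<Phi> g < S + (1/8) ^ j" for j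
  proof -
    have "s (r j) < S + (1/8) ^ j" using S(2)[of "r j"] zero_less_power[of "1/8::real" j] by linarith
    then show ?thesis unfolding s_def using ne bdd by (subst (asm) cINF_less_iff) auto
  qed
  then obtain g where g: "\<And>j. g j \<in> C (r j)" "\<And>j. \<Phi> (g j) < S + (1/8) ^ j" by metis
  have gm [measurable]: "g j \<in> borel_measurable M'" for j using g(1) m' by blast
  define v where "v j x = eexp (g j x) - eexp (g (Suc j) x)" for j x
  have [measurable]: "v j \<in> borel_measurable M'" for j unfolding v_def by measurable
  \<comment> \<open>Both consecutive functions have \<open>\<Phi>\<close> below
    \<open>S + (1/8) ^ j\<close>, and their midpoint has \<open>\<Phi>\<close> at least
    \<open>S - (1/8) ^ j\<close>, so their squared distance is at most \<open>4 * (1/8) ^ j\<close>.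
    The weight \<open>2 ^ j\<close> still leaves a summable series.\<close>
  have v: "(\<integral>\<^sup>+x. ennreal (2 ^ j * (v j x)\<^sup>2) \<partial>M') \<le> ennreal (4 * (1/4) ^ j)" for j
  proof -
    \<comment> \<open>\<open>r\<close> is not arranged to be increasing; the set with the smaller of
      the two indices is the one that contains both functions.\<close>
    define k where "k = min (r j) (r (Suc j))"
    define h where "h x = (g j x + g (Suc j) x) / 2" for x
    have gk: "g j \<in> C k" "g (Suc j) \<in> C k"
      using g(1) dec[of k "r j"] dec[of k "r (Suc j)"] by (auto simp: k_def)
    then have "h \<in> C k" unfolding h_def by (rule mid)
    have "S - (1/8) ^ j \<le> s k"
    proof -
      have "(1/8) ^ Suc j \<le> (1/8 :: real) ^ j" by (intro power_decreasing) auto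
      then have "S - (1/8) ^ j < s (r (Suc j))" using r(2)[of "Suc j"] by linarith
      then show ?thesis using r(2)[of j] by (simp add: k_def min_def)
    qed
    then have \<Phi>h: "S - (1/8) ^ j \<le> \<Phi> h" using s_le[OF \<open>h \<in> C k\<close>] by simp
    have eq: "(v j x)\<^sup>2 = (eexp (g j x) * eexp (g j x) + eexp (g (Suc j) x) * eexp (g (Suc j) x))
        - 2 * (eexp (g j x) * eexp (g (Suc j) x))" for x
      by (simp add: v_def power2_eq_square algebra_simps)
    have i: "integrable M' (\<lambda>x. (v j x)\<^sup>2)"
      unfolding eq using gk by (intro Bochner_Integration.integrable_diff
          Bochner_Integration.integrable_add integrable_mult_right int)
    have "(\<integral>x. (v j x)\<^sup>2 \<partial>M') = \<Phi> (g j) + \<Phi> (g (Suc j)) - 2 * \<Phi> h"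
      unfolding eq \<Phi>_def h_def eexp_midpoint using int gk
      by (subst Bochner_Integration.integral_diff) (auto simp: power2_eq_square)
    also have "\<dots> \<le> 4 * (1/8) ^ j"
    proof -
      have "(1/8) ^ Suc j \<le> (1/8 :: real) ^ j" by (intro power_decreasing) auto
      then show ?thesis using g(2)[of j] g(2)[of "Suc j"] \<Phi>h by linarith
    qed
    finally have "2 ^ j * (\<integral>x. (v j x)\<^sup>2 \<partial>M') \<le> 2 ^ j * (4 * (1/8) ^ j)"
      by (intro mult_left_mono) auto
    also have "\<dots> = 4 * (2 * (1/8)) ^ j" unfolding power_mult_distrib by (simp only: mult_ac)
    finally have "2 ^ j * (\<integral>x. (v j x)\<^sup>2 \<partial>M') \<le> 4 * (1/4) ^ j" by simp
    moreover have "(\<integral>\<^sup>+x. ennreal (2 ^ j * (v j x)\<^sup>2) \<partial>M') = ennreal (\<integral>x. 2 ^ j * (v j x)\<^sup>2 \<partial>M')"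
      using i by (intro nn_integral_eq_integral integrable_mult_right) auto
    ultimately show ?thesis by (simp add: ennreal_leI)
  qed
  have "(\<integral>\<^sup>+x. (\<Sum>j. ennreal (2 ^ j * (v j x)\<^sup>2)) \<partial>M') = (\<Sum>j. \<integral>\<^sup>+x. ennreal (2 ^ j * (v j x)\<^sup>2) \<partial>M')"
    by (intro nn_integral_suminf) measurable
  also have "\<dots> \<le> (\<Sum>j. ennreal (4 * (1/4) ^ j))"
    by (intro suminf_le v) auto
  also have "\<dots> < top"
  proof -
    have "summable (\<lambda>j. 4 * (1/4 :: real) ^ j)" by (intro summable_mult summable_geometric) simp
    then have "(\<Sum>j. ennreal (4 * (1/4) ^ j)) \<noteq> top" by (rule ennreal_suminf_neq_top) simp
    then show ?thesis unfolding less_top .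
  qed
  finally have "AE x in M'. (\<Sum>j. ennreal (2 ^ j * (v j x)\<^sup>2)) \<noteq> \<infinity>"
    by (intro nn_integral_PInf_AE) auto
  then have "AE x in M'. \<exists>L. (\<lambda>m. g m x) \<longlonglongrightarrow> L"
  proof eventually_elim
    case (elim x)
    then have "summable (\<lambda>j. 2 ^ j * (v j x)\<^sup>2)"
      by (intro summable_suminf_not_top) auto
    then have "summable (\<lambda>j. 2 ^ j * (v j x)\<^sup>2 + (1/2) ^ j)"
      by (intro summable_add) auto
    \<comment> \<open>Passes from weighted squares to absolute values: either
      \<open>\<bar>v j x\<bar>\<close> is at most \<open>(1/2) ^ j\<close>, or
      \<open>2 ^ j * \<bar>v j x\<bar>\<close> is at least 1. The telescoping series of increments
      then converges pointwise.\<close>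
    moreover have "\<bar>v j x\<bar> \<le> 2 ^ j * (v j x)\<^sup>2 + (1/2) ^ j" for j
    proof (cases "\<bar>v j x\<bar> \<le> (1/2) ^ j")
      case False
      then have "1 \<le> 2 ^ j * \<bar>v j x\<bar>" by (simp add: field_simps power_divide)
      then have "1 * \<bar>v j x\<bar> \<le> 2 ^ j * \<bar>v j x\<bar> * \<bar>v j x\<bar>"
        by (intro mult_right_mono) auto
      then have "\<bar>v j x\<bar> \<le> 2 ^ j * \<bar>v j x\<bar> * \<bar>v j x\<bar>" by simp
      also have "2 ^ j * \<bar>v j x\<bar> * \<bar>v j x\<bar> = 2 ^ j * (v j x)\<^sup>2"
        by (simp only: mult.assoc abs_mult_self_eq power2_eq_square)
      finally show ?thesis using zero_le_power[of "1/2::real" j] by linarith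
    next
      case True
      moreover have "0 \<le> 2 ^ j * (v j x)\<^sup>2" by simp
      ultimately show ?thesis by linarith
    qed
    ultimately have "summable (\<lambda>j. v j x)"
      using summable_comparison_test'[of "\<lambda>j. 2 ^ j * (v j x)\<^sup>2 + (1/2) ^ j" 0 "\<lambda>j. v j x"]
      by (simp only: real_norm_def)
    then have "convergent (\<lambda>N. \<Sum>j<N. v j x)" by (simp add: summable_iff_convergent)
    moreover have "(\<lambda>N. \<Sum>j<N. v j x) = (\<lambda>N. eexp (g 0 x) - eexp (g N x))"
      unfolding v_def by (intro ext sum_lessThan_telescope')
    ultimately obtain c where "(\<lambda>N. eexp (g 0 x) - eexp (g N x)) \<longlonglongrightarrow> c"
      by (auto simp: convergent_def)
    from tendsto_diff[OF tendsto_const this, of "eexp (g 0 x)"]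
    have "(\<lambda>N. eexp (g N x)) \<longlonglongrightarrow> eexp (g 0 x) - c" by simp
    then show ?case by (rule convergent_if_eexp_convergent)
  qed
  then have "AE x in M. \<exists>L. (\<lambda>m. g m x) \<longlonglongrightarrow> L"
    unfolding M'_def AE_density[OF w] using AE_space by eventually_elim (use wpos in blast)
  \<comment> \<open>This is why \<open>j \<le> r j\<close> was demanded: a function chosen in
    \<open>C (r j)\<close> also lies in the larger set \<open>C j\<close>.\<close>
  moreover have "g j \<in> C j" for j using g(1)[of j] dec[OF r(1)] by auto
  ultimately show ?thesis by blast
qed

section \<open>A countable family of cubes\<close>

lemma space_lebn: "space (lebn n) = space (leb {..<n})"
  by (simp add: lebn_def)

text \<open>Sides run through the integer powers of \<open>\<tau>\<close>, and for side
  \<open>s\<close> the corners run through the lattice of spacing \<open>\<omega> * s\<close>.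
  Proportional spacing allows every cube to be covered at the cost of a fixed factor, and leaves
  only finitely many cubes of sides in a compact range near a bounded set.\<close>

lemma cube_family:
  fixes \<theta> :: real
  assumes "1 < \<theta>"
  obtains a :: "nat \<Rightarrow> nat \<Rightarrow> real" and s :: "nat \<Rightarrow> real" where
    "\<And>i. 0 < s i"
    "\<And>a' l. 0 < l \<Longrightarrow> \<exists>i. s i \<le> \<theta> * l \<and> cube n a' l \<subseteq> cube n (a i) (s i)"
    "\<And>L r R. 0 < r \<Longrightarrow> finite {i. r \<le> s i \<and> s i \<le> R \<and> cube n (a i) (s i) \<inter> cube n (\<lambda>_. - L) (2 * L) \<noteq> {}}"
proof -
  \<comment> \<open>\<open>\<theta>\<close> is split into two equal factors: one pays for rounding
    the side up to a power of \<open>\<tau>\<close>, the other for moving the corner to the lattice.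
    The choice of \<open>\<omega>\<close> makes a shift by \<open>\<omega> * s\<close> followed by a
    side \<open>s / \<tau>\<close> fit exactly into \<open>s\<close>.\<close>
  define \<tau> where "\<tau> = sqrt \<theta>"
  have \<tau>: "1 < \<tau>" "\<tau> * \<tau> = \<theta>" using assms by (auto simp: \<tau>_def)
  define \<omega> where "\<omega> = 1 - 1 / \<tau>"
  have \<omega>: "0 < \<omega>" using \<tau> by (simp add: \<omega>_def)
  define D where "D = (UNIV :: int set) \<times> PiE {..<n} (\<lambda>_. UNIV :: int set)"
  define S where "S z = \<tau> powr of_int (fst z)" for z :: "int \<times> (nat \<Rightarrow> int)"
  define A where "A z c = \<omega> * S z * of_int (snd z c)" for z :: "int \<times> (nat \<Rightarrow> int)" and c
  have Spos: "0 < S z" for z using \<tau> by (simp add: S_def)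
  have "PiE {..<n} (\<lambda>_. UNIV :: int set) \<noteq> {}" by (simp add: PiE_eq_empty_iff)
  then have D: "infinite D"
    unfolding D_def using finite_cartesian_productD1 infinite_UNIV_int by blast
  \<comment> \<open>Injectivity of the enumeration matters for local finiteness, which counts
    indices.\<close>
  have "countable D" unfolding D_def by (intro countable_SIGMA countable_PiE) auto
  then have bij: "bij_betw (from_nat_into D) UNIV D" using D by (rule bij_betw_from_nat_into)
  show thesis
  proof (rule that[of "\<lambda>i. S (from_nat_into D i)" "\<lambda>i. A (from_nat_into D i)"])
    show "0 < S (from_nat_into D i)" for i by (rule Spos)
  next
    fix a' :: "nat \<Rightarrow> real" and l :: real assume l: "0 < l"
    define j where "j = \<lceil>log \<tau> (\<tau> * l)\<rceil>"
    define s where "s = \<tau> powr of_int j"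
    define z where "z = (j, restrict (\<lambda>c. \<lfloor>a' c / (\<omega> * s)\<rfloor>) {..<n})"
    have s: "0 < s" using \<tau> by (simp add: s_def)
    have "\<tau> * l = \<tau> powr log \<tau> (\<tau> * l)" using \<tau> l by simp
    also have "\<dots> \<le> s" unfolding s_def j_def using \<tau> by (intro powr_mono) linarith+
    finally have low: "l \<le> s / \<tau>" using \<tau> by (simp add: field_simps)
    have "s \<le> \<tau> powr (log \<tau> (\<tau> * l) + 1)" unfolding s_def j_def using \<tau> by (intro powr_mono) linarith+
    also have "\<dots> = \<theta> * l" using \<tau> l by (simp add: powr_add mult_ac flip: \<tau>(2))
    finally have up: "s \<le> \<theta> * l" .
    have Sz: "S z = s" by (simp add: S_def z_def s_def)
    have "z \<in> D" by (auto simp: D_def z_def)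
    then obtain i where i: "from_nat_into D i = z" using bij by (metis bij_betw_iff_bijections)
    have "cube n a' l \<subseteq> cube n (A z) (S z)"
    proof
      fix x assume x: "x \<in> cube n a' l"
      have "A z c \<le> x c \<and> x c \<le> A z c + S z" if c: "c < n" for c
      proof -
        have Az: "A z c = \<omega> * s * of_int \<lfloor>a' c / (\<omega> * s)\<rfloor>"
          using c by (simp add: A_def Sz) (simp add: z_def)
        have "\<omega> * s * of_int \<lfloor>a' c / (\<omega> * s)\<rfloor> \<le> \<omega> * s * (a' c / (\<omega> * s))"
          using \<omega> s by (intro mult_left_mono) auto
        also have "\<dots> = a' c" using \<omega> s by simp
        finally have 1: "A z c \<le> a' c" by (simp add: Az)
        have "a' c = \<omega> * s * (a' c / (\<omega> * s))" using \<omega> s by simp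
        also have "\<dots> \<le> \<omega> * s * (of_int \<lfloor>a' c / (\<omega> * s)\<rfloor> + 1)"
          using \<omega> s by (intro mult_left_mono) (linarith, simp)
        also have "\<dots> = A z c + \<omega> * s" by (simp add: Az distrib_left)
        finally have "a' c \<le> A z c + \<omega> * s" .
        moreover have "\<omega> * s + s / \<tau> = s" by (simp add: \<omega>_def left_diff_distrib)
        ultimately show ?thesis using x c 1 low by (auto simp: cube_def Sz)
      qed
      then show "x \<in> cube n (A z) (S z)" using x by (auto simp: cube_def)
    qed
    then show "\<exists>i. S (from_nat_into D i) \<le> \<theta> * l \<and> cube n a' l \<subseteq> cube n (A (from_nat_into D i)) (S (from_nat_into D i))"
      using i up Sz by metis
  next
    fix L r R :: real assume r: "0 < r"
    let ?I = "{i. r \<le> S (from_nat_into D i) \<and> S (from_nat_into D i) \<le> R \<and>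
      cube n (A (from_nat_into D i)) (S (from_nat_into D i)) \<inter> cube n (\<lambda>_. - L) (2 * L) \<noteq> {}}"
    \<comment> \<open>A cube of side at most \<open>R\<close> that meets the box has its corner
      within \<open>\<bar>L\<bar> + R\<close> of the origin in each coordinate, and the lattice
      spacing is at least \<open>\<omega> * r\<close>.\<close>
    define B where "B = \<lceil>(\<bar>L\<bar> + R) / (\<omega> * r)\<rceil>"
    have "from_nat_into D ` ?I \<subseteq> {\<lfloor>log \<tau> r\<rfloor>..\<lceil>log \<tau> R\<rceil>} \<times> PiE {..<n} (\<lambda>_. {- B..B})"
    proof
      fix z assume "z \<in> from_nat_into D ` ?I"
      then obtain x where z: "z \<in> D" "r \<le> S z" "S z \<le> R"
        and x: "x \<in> cube n (A z) (S z)" "x \<in> cube n (\<lambda>_. - L) (2 * L)"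
        using bij by (auto simp: bij_betw_def)
      have "log \<tau> r \<le> log \<tau> (S z)" "log \<tau> (S z) \<le> log \<tau> R"
        using \<tau> r z by (auto intro!: log_mono)
      then have "log \<tau> r \<le> of_int (fst z)" "of_int (fst z) \<le> log \<tau> R"
        using \<tau> by (simp_all add: S_def)
      then have 1: "fst z \<in> {\<lfloor>log \<tau> r\<rfloor>..\<lceil>log \<tau> R\<rceil>}"
        by (auto simp: floor_le_iff le_ceiling_iff)
      have "snd z c \<in> {- B..B}" if c: "c < n" for c
      proof -
        have "A z c \<le> x c" "x c \<le> A z c + S z" "- L \<le> x c" "x c \<le> L"
          using x c by (force simp: cube_def)+
        then have "\<bar>A z c\<bar> \<le> \<bar>L\<bar> + R" using z Spos[of z] by linarith
        then have "\<omega> * S z * \<bar>of_int (snd z c)\<bar> \<le> \<bar>L\<bar> + R"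
          using \<omega> Spos[of z] by (simp add: A_def abs_mult)
        moreover have "\<omega> * r * \<bar>of_int (snd z c)\<bar> \<le> \<omega> * S z * \<bar>real_of_int (snd z c)\<bar>"
          using \<omega> z by (intro mult_right_mono mult_left_mono) auto
        ultimately have "\<bar>of_int (snd z c)\<bar> * (\<omega> * r) \<le> \<bar>L\<bar> + R" by (simp add: mult_ac)
        then have "\<bar>of_int (snd z c)\<bar> \<le> (\<bar>L\<bar> + R) / (\<omega> * r)"
          using \<omega> r by (simp add: pos_le_divide_eq)
        then have "\<bar>snd z c\<bar> \<le> B" unfolding B_def by linarith
        then show ?thesis by auto
      qed
      then have "snd z \<in> PiE {..<n} (\<lambda>_. {- B..B})"
        using z(1) by (auto simp: D_def PiE_iff)
      with 1 show "z \<in> {\<lfloor>log \<tau> r\<rfloor>..\<lceil>log \<tau> R\<rceil>} \<times> PiE {..<n} (\<lambda>_. {- B..B})"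
        by (cases z) auto
    qed
    then have "finite (from_nat_into D ` ?I)"
      by (rule finite_subset) (auto intro!: finite_PiE)
    then show "finite ?I"
      by (rule finite_imageD) (use bij in \<open>auto simp: bij_betw_def intro: inj_on_subset\<close>)
  qed
qed

section \<open>Families of functions subordinate to a family of cubes\<close>

lemma cube_eq_PiE: "cube n a l = PiE {..<n} (\<lambda>i. {a i..a i + l})"
proof (rule set_eqI)
  show "x \<in> cube n a l \<longleftrightarrow> x \<in> PiE {..<n} (\<lambda>i. {a i..a i + l})" for x
    unfolding cube_def space_lebn space_leb PiE_iff mem_Collect_eq by auto
qed

lemma cube_in_sets [measurable]: "cube n a l \<in> sets (leb {..<n})"
  unfolding cube_eq_PiE by (intro sets_PiM_I_finite) auto

lemma not_in_cube: "x \<in> space (leb {..<n}) \<Longrightarrow> \<exists>i<n. x i \<notin> {a i..a i + l} \<Longrightarrow> x \<notin> cube n a l"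
  by (auto simp: cube_def)

abbreviation ccube :: "nat \<Rightarrow> real \<Rightarrow> (nat \<Rightarrow> real) set" where
  "ccube n L \<equiv> cube n (\<lambda>_. - L) (2 * L)"

lemma space_leb_eq_Union_ccube: "x \<in> space (leb {..<n}) \<Longrightarrow> \<exists>L::nat. 0 < L \<and> x \<in> ccube n (real L)"
proof -
  assume x: "x \<in> space (leb {..<n})"
  define B where "B = (\<Sum>i<n. \<bar>x i\<bar>)"
  obtain L :: nat where L: "B < real L" using reals_Archimedean2 by blast
  have "\<bar>x i\<bar> \<le> B" if "i < n" for i
    unfolding B_def using that by (intro member_le_sum) auto
  moreover have "0 \<le> B" by (simp add: B_def sum_nonneg)
  ultimately show ?thesis using L x
    by (intro exI[of _ L]) (force simp: cube_def space_lebn abs_le_iff)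
qed

locale block_exponents =
  fixes n :: nat and p0 :: real and p :: "nat \<Rightarrow> real"
  assumes p0: "1 < p0" and p: "\<And>i. i < n \<Longrightarrow> 1 < p i"
    and sum_p: "real n / p0 < (\<Sum>i<n. 1 / p i)"
begin

definition q :: "nat \<Rightarrow> real" where "q i = conj_exp (p i)"
text \<open>The power of the side produced by Hoelder's inequality on a cube, because
  \<open>1 - 1 / q i = 1 / p i\<close>.\<close>

definition \<sigma> :: real where "\<sigma> = (\<Sum>i<n. 1 / p i)"
definition \<rho> :: real where "\<rho> = \<sigma> - real n / p0"

abbreviation X :: "(nat \<Rightarrow> real) measure" where "X \<equiv> leb {..<n}"
abbreviation N :: "((nat \<Rightarrow> real) \<Rightarrow> ennreal) \<Rightarrow> ennreal" where "N \<equiv> mnorm n q"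

lemma n_pos: "0 < n"
  using sum_p by (cases n) auto

lemma \<rho>_pos: "0 < \<rho>"
  using sum_p by (simp add: \<rho>_def \<sigma>_def)

lemma q_gt_1: "i < n \<Longrightarrow> 1 < q i"
  using p[of i] by (simp add: q_def conj_exp_def)

lemma q_pos: "i < n \<Longrightarrow> 0 < q i" and q_ge_1: "i < n \<Longrightarrow> 1 \<le> q i"
  using q_gt_1[of i] by auto

lemma sum_q: "(\<Sum>i<n. 1 - 1 / q i) = \<sigma>"
  unfolding \<sigma>_def
proof (rule sum.cong)
  fix i assume "i \<in> {..<n}"
  then show "1 - 1 / q i = 1 / p i"
    using p[of i] by (simp add: q_def conj_exp_def field_simps)
qed simp

lemma block_bound_eq:
  assumes "0 < l" shows "(l ^ n) powr (1 / p0 - (1 / real n) * (\<Sum>i<n. 1 / p i)) = l powr (- \<rho>)"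
proof -
  have "l ^ n = l powr real n" using assms by (simp add: powr_realpow)
  moreover have "real n * (1 / p0 - (1 / real n) * (\<Sum>i<n. 1 / p i)) = - \<rho>"
    using n_pos by (simp add: \<rho>_def \<sigma>_def right_diff_distrib)
  ultimately show ?thesis by (simp add: powr_powr)
qed

section \<open>Local mass of functions supported in a cube\<close>

lemma nn_integral_le_N:
  assumes "0 < l" and g: "g \<in> borel_measurable X"
    and off: "\<And>x. x \<in> space X \<Longrightarrow> x \<notin> cube n a l \<Longrightarrow> g x = 0"
  shows "(\<integral>\<^sup>+ x. g x \<partial>X) \<le> ennreal (2 ^ n * l powr \<sigma>) * N g"
  using nn_integral_le_mnorm[where q = q and n = n and a = a, OF q_gt_1 \<open>0 < l\<close> g] off not_in_cube
  by (simp add: sum_q)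

text \<open>Bounds the integral over the box \<open>ccube n L\<close> of a piece with coefficient
  one and side \<open>s\<close>. The first term is Hoelder on the piece's own cube, where
  \<open>\<sigma> - \<rho> = n / p0\<close>; the second is Hoelder on the box.\<close>

definition local_const :: "real \<Rightarrow> real \<Rightarrow> real" where
  "local_const L s = min (2 ^ n * s powr (real n / p0)) (2 ^ n * (2 * L) powr \<sigma> * s powr (- \<rho>))"

text \<open>Comparison with the cube itself is efficient for small cubes, comparison with the box for
  large ones.\<close>
lemma ccube_integral_le:
  assumes "0 < s" "0 < L" and g: "g \<in> borel_measurable X"
    and off: "\<And>x. x \<in> space X \<Longrightarrow> x \<notin> cube n a s \<Longrightarrow> g x = 0"
  shows "(\<integral>\<^sup>+ x. g x * indicator (ccube n L) x \<partial>X) \<le> ennreal (local_const L s) * (ennreal (s powr \<rho>) * N g)"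
proof -
  have "(\<integral>\<^sup>+ x. g x * indicator (ccube n L) x \<partial>X) \<le> (\<integral>\<^sup>+ x. g x \<partial>X)"
    by (intro nn_integral_mono) (auto simp: indicator_def)
  also have "\<dots> \<le> ennreal (2 ^ n * s powr \<sigma>) * N g"
    by (rule nn_integral_le_N[OF \<open>0 < s\<close> g off])
  also have "2 ^ n * s powr \<sigma> = 2 ^ n * s powr (real n / p0) * s powr \<rho>"
    by (simp add: \<rho>_def mult.assoc flip: powr_add)
  finally have 1: "(\<integral>\<^sup>+ x. g x * indicator (ccube n L) x \<partial>X)
      \<le> ennreal (2 ^ n * s powr (real n / p0)) * (ennreal (s powr \<rho>) * N g)"
    by (simp add: ennreal_mult mult.assoc)
  have "(\<integral>\<^sup>+ x. g x * indicator (ccube n L) x \<partial>X)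
      \<le> ennreal (2 ^ n * (2 * L) powr \<sigma>) * N (\<lambda>x. g x * indicator (ccube n L) x)"
    using \<open>0 < L\<close> g by (intro nn_integral_le_N) (auto simp: indicator_def)
  also have "\<dots> \<le> ennreal (2 ^ n * (2 * L) powr \<sigma>) * N g"
    by (intro mult_left_mono mnorm_mono_AE q_pos) (auto simp: indicator_def)
  also have "2 ^ n * (2 * L) powr \<sigma> = 2 ^ n * (2 * L) powr \<sigma> * s powr (- \<rho>) * s powr \<rho>"
    using \<open>0 < s\<close> by (simp add: mult.assoc flip: powr_add)
  finally have 2: "(\<integral>\<^sup>+ x. g x * indicator (ccube n L) x \<partial>X)
      \<le> ennreal (2 ^ n * (2 * L) powr \<sigma> * s powr (- \<rho>)) * (ennreal (s powr \<rho>) * N g)"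
    by (simp add: ennreal_mult mult.assoc)
  from 1 2 show ?thesis by (simp add: local_const_def min_def)
qed

text \<open>A bound independent of the side, so that summable coefficients alone control the series
  on every box. The first term is used for \<open>s \<le> 1\<close>, the second beyond.\<close>

lemma local_const_le:
  assumes "0 < s" "0 < L"
  shows "local_const L s \<le> 2 ^ n * (1 + (2 * L) powr \<sigma>)"
proof (cases "s \<le> 1")
  case True
  have "local_const L s \<le> 2 ^ n * s powr (real n / p0)" by (simp add: local_const_def)
  also have "s powr (real n / p0) \<le> 1 powr (real n / p0)"
    using True assms p0 by (intro powr_mono2) auto
  finally have "local_const L s \<le> 2 ^ n" by simp
  moreover have "2 ^ n \<le> 2 ^ n * (1 + (2 * L) powr \<sigma>)" by simp
  ultimately show ?thesis by linarith
next
  case False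
  have "local_const L s \<le> 2 ^ n * (2 * L) powr \<sigma> * s powr (- \<rho>)" by (simp add: local_const_def)
  also have "s powr (- \<rho>) \<le> 1 powr (- \<rho>)"
    using False \<rho>_pos by (intro powr_mono2') auto
  finally have "local_const L s \<le> 2 ^ n * (2 * L) powr \<sigma>" by (simp add: mult_left_mono)
  moreover have "2 ^ n * (2 * L) powr \<sigma> \<le> 2 ^ n * (1 + (2 * L) powr \<sigma>)" by (intro mult_left_mono) auto
  ultimately show ?thesis by linarith
qed

text \<open>The first term tends to 0 as \<open>s\<close> does, the second as \<open>s\<close>
  grows; the latter is the hypothesis \<open>sum_p\<close> in the form
  \<open>\<rho>_pos\<close>.\<close>

lemma local_const_small:
  assumes "0 < L" "0 < \<eta>"
  obtains r R where "0 < r" "\<And>s. 0 < s \<Longrightarrow> s < r \<or> R < s \<Longrightarrow> local_const L s \<le> \<eta>"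
proof
  define \<kappa> where "\<kappa> = 2 ^ n * (2 * L) powr \<sigma>"
  have \<kappa>: "0 < \<kappa>" using assms by (simp add: \<kappa>_def)
  \<comment> \<open>\<open>r\<close> and \<open>R\<close> are the sides at which the first and the
    second term of \<open>local_const\<close> equal \<open>\<eta>\<close>.\<close>
  define r where "r = (\<eta> / 2 ^ n) powr (p0 / n)"
  define R where "R = (\<kappa> / \<eta>) powr (1 / \<rho>)"
  show "0 < r" using assms by (simp add: r_def)
  fix s :: real assume s: "0 < s" "s < r \<or> R < s"
  from s(2) show "local_const L s \<le> \<eta>"
  proof
    assume "s < r"
    then have "s powr (real n / p0) \<le> r powr (real n / p0)" using s p0 by (intro powr_mono2) auto
    also have "\<dots> = \<eta> / 2 ^ n" using n_pos p0 assms by (simp add: r_def powr_powr)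
    finally have "2 ^ n * s powr (real n / p0) \<le> \<eta>" by (simp add: field_simps)
    then show ?thesis by (simp add: local_const_def)
  next
    assume "R < s"
    have R: "0 < R" using \<kappa> assms by (simp add: R_def)
    have "s powr (- \<rho>) \<le> R powr (- \<rho>)" using R \<open>R < s\<close> \<rho>_pos by (intro powr_mono2') auto
    also have "\<dots> = \<eta> / \<kappa>"
      using \<rho>_pos \<kappa> assms by (simp add: R_def powr_powr powr_minus)
    finally have "\<kappa> * s powr (- \<rho>) \<le> \<eta>" using \<kappa> by (simp add: field_simps)
    then show ?thesis by (simp add: local_const_def \<kappa>_def)
  qed
qed

text \<open>The number \<open>s i powr \<rho> * N (g i)\<close> is the coefficient that makes \<open>g i\<close> a multiple of a block
  supported in the \<open>i\<close>-th cube.\<close>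
definition fam :: "(nat \<Rightarrow> nat \<Rightarrow> real) \<Rightarrow> (nat \<Rightarrow> real) \<Rightarrow> ennreal \<Rightarrow> (nat \<Rightarrow> (nat \<Rightarrow> real) \<Rightarrow> ennreal) \<Rightarrow> bool" where
  "fam a s W g \<longleftrightarrow> (\<forall>i. g i \<in> borel_measurable X) \<and>
     (\<forall>i. \<forall>x\<in>space X. x \<notin> cube n (a i) (s i) \<longrightarrow> g i x = 0) \<and>
     (\<Sum>i. ennreal (s i powr \<rho>) * N (g i)) \<le> W"

lemma famD:
  assumes "fam a s W g"
  shows "g i \<in> borel_measurable X" "x \<in> space X \<Longrightarrow> x \<notin> cube n (a i) (s i) \<Longrightarrow> g i x = 0"
    "(\<Sum>i. ennreal (s i powr \<rho>) * N (g i)) \<le> W"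
  using assms by (auto simp: fam_def)

end

section \<open>From block decompositions to dominating families\<close>

lemma AE_lebn: "(AE x in lebn n. P x) \<longleftrightarrow> (AE x in leb {..<n}. P x)"
  unfolding lebn_def by (rule AE_completion_iff)

lemma suminf_ennreal_swap:
  fixes f :: "nat \<Rightarrow> nat \<Rightarrow> ennreal"
  shows "(\<Sum>i. \<Sum>j. f i j) = (\<Sum>j. \<Sum>i. f i j)"
  using nn_integral_suminf[of "\<lambda>j i. f i j" "count_space UNIV"] by (simp add: nn_integral_count_space_nat)

lemma suminf_ennreal_single: "(\<Sum>i. if i = k then c else 0) = (c :: ennreal)"
  using sums_unique[OF sums_single[of k "\<lambda>_. c"]] by simp

context block_exponents
begin

text \<open>Moves a block to a cube of the fixed collection. The side grows by at most the factor
  \<open>\<theta>\<close>, which raises the coefficient by at most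
  \<open>\<theta> powr \<rho>\<close>.\<close>

lemma fam_member_of_block:
  assumes b: "is_block n p0 p b" and s: "\<And>i. 0 < s i"
    and cover: "\<And>a' l. 0 < l \<Longrightarrow> \<exists>i. s i \<le> \<theta> * l \<and> cube n a' l \<subseteq> cube n (a i) (s i)"
  shows "\<exists>i B. B \<in> borel_measurable X \<and> (\<forall>x\<in>space X. x \<notin> cube n (a i) (s i) \<longrightarrow> B x = 0) \<and>
    (AE x in X. ennreal \<bar>b x\<bar> = B x) \<and> ennreal (s i powr \<rho>) * N B \<le> ennreal (\<theta> powr \<rho>)"
proof -
  obtain a' l where l: "0 < l" and supp: "{x \<in> space X. b x \<noteq> 0} \<subseteq> cube n a' l"
    and nb: "N (\<lambda>x. ennreal \<bar>b x\<bar>) \<le> ennreal (l powr (- \<rho>))"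
    using b block_bound_eq unfolding is_block_def space_lebn mixed_norm_eq_mnorm
    by (auto simp: q_def[abs_def])
  have "b \<in> borel_measurable (completion X)" using b by (simp add: is_block_def lebn_def)
  then obtain b' where [measurable]: "b' \<in> borel_measurable X" and b': "AE x in X. b x = b' x"
    using completion_ex_borel_measurable_real by blast
  obtain i where i: "s i \<le> \<theta> * l" "cube n a' l \<subseteq> cube n (a i) (s i)" using cover[OF l] by blast
  \<comment> \<open>The Borel version agrees with the block almost everywhere only, so it is cut off
    to vanish at every point outside the cube.\<close>
  define B where "B x = ennreal \<bar>b' x\<bar> * indicator (cube n (a i) (s i)) x" for x
  have B: "B \<in> borel_measurable X" unfolding B_def by measurable
  have AE: "AE x in X. ennreal \<bar>b x\<bar> = B x"
    using b' AE_space
  proof eventually_elim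
    case (elim x)
    then show ?case using supp i(2) by (cases "b x = 0") (auto simp: B_def indicator_def)
  qed
  then have "N B \<le> N (\<lambda>x. ennreal \<bar>b x\<bar>)" by (intro mnorm_mono_AE q_pos) (auto elim: eventually_mono)
  also note nb
  finally have "ennreal (s i powr \<rho>) * N B \<le> ennreal (s i powr \<rho>) * ennreal (l powr (- \<rho>))"
    by (intro mult_left_mono) auto
  also have "\<dots> = ennreal ((s i / l) powr \<rho>)"
    using l s[of i] by (simp add: powr_divide powr_minus_divide flip: ennreal_mult)
  also have "\<dots> \<le> ennreal (\<theta> powr \<rho>)"
    using i(1) l s[of i] \<rho>_pos by (intro ennreal_leI powr_mono2) (auto simp: field_simps)
  finally show ?thesis using B AE by (intro exI[of _ i] exI[of _ B]) (auto simp: B_def)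
qed

lemma fam_of_decomp:
  assumes dec: "block_decomp n p0 p F lam b" and s: "\<And>i. 0 < s i"
    and cover: "\<And>a' l. 0 < l \<Longrightarrow> \<exists>i. s i \<le> \<theta> * l \<and> cube n a' l \<subseteq> cube n (a i) (s i)"
  shows "\<exists>g. fam a s (ennreal (\<theta> powr \<rho> * (\<Sum>j. \<bar>lam j\<bar>))) g \<and> (AE x in X. ennreal \<bar>F x\<bar> \<le> (\<Sum>i. g i x))"
proof -
  have sm: "summable (\<lambda>j. \<bar>lam j\<bar>)" and bl: "\<And>j. is_block n p0 p (b j)"
    and lim: "AE x in X. (\<lambda>m. \<Sum>j<m. lam j * b j x) \<longlonglongrightarrow> F x"
    using dec unfolding block_decomp_def AE_lebn by auto
  let ?P = "\<lambda>j i B. B \<in> borel_measurable X \<and> (\<forall>x\<in>space X. x \<notin> cube n (a i) (s i) \<longrightarrow> B x = 0) \<and>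
    (AE x in X. ennreal \<bar>b j x\<bar> = B x) \<and> ennreal (s i powr \<rho>) * N B \<le> ennreal (\<theta> powr \<rho>)"
  have "\<forall>j. \<exists>i B. ?P j i B"
    using fam_member_of_block[OF bl s cover] by blast
  from choice[OF this] obtain \<iota> where "\<forall>j. \<exists>B. ?P j (\<iota> j) B" by blast
  from choice[OF this] obtain B where "\<forall>j. ?P j (\<iota> j) (B j)" by blast
  then have B [measurable]: "\<And>j. B j \<in> borel_measurable X"
    and off: "\<And>j x. x \<in> space X \<Longrightarrow> x \<notin> cube n (a (\<iota> j)) (s (\<iota> j)) \<Longrightarrow> B j x = 0"
    and AEB: "\<And>j. AE x in X. ennreal \<bar>b j x\<bar> = B j x"
    and nB: "\<And>j. ennreal (s (\<iota> j) powr \<rho>) * N (B j) \<le> ennreal (\<theta> powr \<rho>)"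
    by blast+
  \<comment> \<open>All blocks assigned to the same cube are merged, with the absolute values of
    their coefficients.\<close>
  define g where "g i x = (\<Sum>j. (if i = \<iota> j then ennreal \<bar>lam j\<bar> else 0) * B j x)" for i x
  have gm: "g i \<in> borel_measurable X" for i unfolding g_def[abs_def] by measurable
  have g0: "g i x = 0" if "x \<in> space X" "x \<notin> cube n (a i) (s i)" for i x
  proof -
    have "(if i = \<iota> j then ennreal \<bar>lam j\<bar> else 0) * B j x = 0" for j
      using that off by auto
    then show ?thesis unfolding g_def by (simp only: suminf_zero)
  qed
  have Ng: "N (g i) \<le> (\<Sum>j. (if i = \<iota> j then ennreal \<bar>lam j\<bar> else 0) * N (B j))" for i
  proof -
    have "N (g i) \<le> (\<Sum>j. N (\<lambda>x. (if i = \<iota> j then ennreal \<bar>lam j\<bar> else 0) * B j x))"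
      unfolding g_def[abs_def] by (intro mnorm_suminf_le q_ge_1) measurable
    then show ?thesis by (simp only: mnorm_cmult[OF q_pos B])
  qed
  have "(\<Sum>i. ennreal (s i powr \<rho>) * N (g i))
      \<le> (\<Sum>i. ennreal (s i powr \<rho>) * (\<Sum>j. (if i = \<iota> j then ennreal \<bar>lam j\<bar> else 0) * N (B j)))"
    by (intro suminf_le mult_left_mono Ng) auto
  also have "\<dots> = (\<Sum>i. \<Sum>j. if i = \<iota> j then ennreal \<bar>lam j\<bar> * (ennreal (s (\<iota> j) powr \<rho>) * N (B j)) else 0)"
    unfolding ennreal_suminf_cmult[symmetric]
    by (intro suminf_cong) (auto simp: mult.left_commute)
  \<comment> \<open>After exchanging the sums, each \<open>j\<close> contributes to the single index
    \<open>\<iota> j\<close>.\<close>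
  also have "\<dots> = (\<Sum>j. ennreal \<bar>lam j\<bar> * (ennreal (s (\<iota> j) powr \<rho>) * N (B j)))"
    by (subst suminf_ennreal_swap) (simp only: suminf_ennreal_single)
  also have "\<dots> \<le> (\<Sum>j. ennreal \<bar>lam j\<bar> * ennreal (\<theta> powr \<rho>))"
    by (intro suminf_le mult_left_mono nB) auto
  also have "\<dots> = ennreal (\<Sum>j. \<bar>lam j\<bar>) * ennreal (\<theta> powr \<rho>)"
    unfolding ennreal_suminf_multc using sm by (subst suminf_ennreal2) auto
  also have "\<dots> = ennreal (\<theta> powr \<rho> * (\<Sum>j. \<bar>lam j\<bar>))"
    using sm by (simp add: ennreal_mult suminf_nonneg mult.commute)
  finally have "fam a s (ennreal (\<theta> powr \<rho> * (\<Sum>j. \<bar>lam j\<bar>))) g"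
    using g0 gm by (auto simp: fam_def)
  moreover have "AE x in X. \<forall>j. ennreal \<bar>b j x\<bar> = B j x" using AEB by (simp add: AE_all_countable)
  then have "AE x in X. ennreal \<bar>F x\<bar> \<le> (\<Sum>i. g i x)"
    using lim
  proof eventually_elim
    case (elim x)
    have "(\<Sum>i. g i x) = (\<Sum>j. \<Sum>i. if i = \<iota> j then ennreal \<bar>lam j\<bar> * B j x else 0)"
      unfolding g_def by (subst suminf_ennreal_swap) (intro suminf_cong, simp)
    also have "\<dots> = (\<Sum>j. ennreal \<bar>lam j * b j x\<bar>)"
      using elim(1) by (simp only: suminf_ennreal_single abs_mult) (simp add: ennreal_mult)
    finally have eq: "(\<Sum>i. g i x) = (\<Sum>j. ennreal \<bar>lam j * b j x\<bar>)" .
    have le: "ennreal \<bar>\<Sum>j<m. lam j * b j x\<bar> \<le> (\<Sum>j. ennreal \<bar>lam j * b j x\<bar>)" for m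
    proof -
      have "ennreal \<bar>\<Sum>j<m. lam j * b j x\<bar> \<le> ennreal (\<Sum>j<m. \<bar>lam j * b j x\<bar>)"
        by (intro ennreal_leI sum_abs)
      also have "\<dots> = (\<Sum>j<m. ennreal \<bar>lam j * b j x\<bar>)" by simp
      also have "\<dots> \<le> (\<Sum>j. ennreal \<bar>lam j * b j x\<bar>)" by (intro sum_le_suminf) auto
      finally show ?thesis .
    qed
    have "(\<lambda>m. ennreal \<bar>\<Sum>j<m. lam j * b j x\<bar>) \<longlonglongrightarrow> ennreal \<bar>F x\<bar>"
      using elim(2) by (intro tendsto_intros)
    then show ?case unfolding eq by (rule LIMSEQ_le_const2) (use le in blast)
  qed
  ultimately show ?thesis by blast
qed

end

section \<open>From dominating families back to block decompositions\<close>

lemma compact_subset_ccube: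
  assumes "compact K" "K \<subseteq> space (lebn n)"
  shows "\<exists>L>0. K \<subseteq> ccube n L"
proof -
  have "\<exists>B. \<forall>x\<in>K. \<bar>x i\<bar> \<le> B" for i
  proof -
    have "compact ((\<lambda>x. x i) ` K)"
      by (intro compact_continuous_image assms(1) continuous_on_subset[OF continuous_on_product_coordinates subset_UNIV])
    then show ?thesis
      by (auto dest!: compact_imp_bounded simp: bounded_iff)
  qed
  then obtain B where B: "\<And>i x. x \<in> K \<Longrightarrow> \<bar>x i\<bar> \<le> B i" by metis
  define L where "L = 1 + (\<Sum>i<n. \<bar>B i\<bar>)"
  have "\<bar>x i\<bar> \<le> L" if "i < n" "x \<in> K" for i x
  proof -
    have "\<bar>B i\<bar> \<le> (\<Sum>i<n. \<bar>B i\<bar>)" using that by (intro member_le_sum) auto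
    with B[OF that(2), of i] show ?thesis by (simp add: L_def)
  qed
  then have "K \<subseteq> ccube n L"
    using assms(2) by (fastforce simp: cube_def abs_le_iff)
  moreover have "0 < L" by (simp add: L_def sum_nonneg add_pos_nonneg)
  ultimately show ?thesis by blast
qed

context block_exponents
begin

text \<open>The function is split among the cubes in proportion to \<open>g i x / G x\<close>. Since
  \<open>\<bar>f' x\<bar> \<le> G x\<close>, the \<open>i\<close>-th part is bounded by
  \<open>g i x\<close>: it inherits the norm bound, and the remainders are bounded by the tails of
  \<open>G\<close>.\<close>

lemma decomp_of_fam:
  assumes s: "\<And>i. 0 < s i" and g: "fam a s (ennreal W) g" and W: "0 \<le> W" and \<epsilon>: "0 < \<epsilon>"
    and f' [measurable]: "f' \<in> borel_measurable X" and f'g: "AE x in X. ennreal \<bar>f' x\<bar> \<le> (\<Sum>i. g i x)"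
    and ff': "AE x in X. f x = f' x"
  shows "\<exists>lam b. block_decomp n p0 p f lam b \<and> (\<Sum>i. \<bar>lam i\<bar>) \<le> W + \<epsilon>"
proof -
  note gm [measurable] = famD(1)[OF g]
  define w where "w i = enn2real (ennreal (s i powr \<rho>) * N (g i))" for i
  have fin: "ennreal (s i powr \<rho>) * N (g i) < top" for i
    using le_less_trans[OF famD(3)[OF g] ennreal_less_top] by (rule ennreal_suminf_lessD)
  have w: "ennreal (s i powr \<rho>) * N (g i) = ennreal (w i)" for i
    using fin[of i] by (simp add: w_def)
  have w0: "0 \<le> w i" for i by (simp add: w_def)
  have sw: "(\<Sum>i. ennreal (w i)) \<le> ennreal W" using famD(3)[OF g] by (simp only: w)
  then have "(\<Sum>i. ennreal (w i)) \<noteq> top" using neq_top_trans ennreal_neq_top by blast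
  with w0 have summ_w: "summable w" by (intro summable_suminf_not_top)
  then have sum_w: "suminf w \<le> W" using sw W w0 by (simp add: suminf_ennreal2)
  \<comment> \<open>The extra term makes every coefficient positive, so that one may divide by it
    even if \<open>w i = 0\<close>; the additions sum to \<open>\<epsilon>\<close>.\<close>
  define lam where "lam i = w i + \<epsilon> * (1/2) ^ Suc i" for i
  have lam: "0 < lam i" "w i \<le> lam i" for i using w0[of i] \<epsilon> by (auto simp: lam_def add_nonneg_pos)
  have "lam sums (suminf w + \<epsilon> * 1)"
    unfolding lam_def[abs_def] using summ_w
    by (intro sums_add sums_mult power_half_series summable_sums)
  then have lam_sum: "summable lam" "suminf lam \<le> W + \<epsilon>"
    using sum_w by (auto simp: sums_iff)
  define G where "G x = (\<Sum>i. g i x)" for x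
  have [measurable]: "G \<in> borel_measurable X" unfolding G_def[abs_def] by measurable
  have tail: "(\<integral>\<^sup>+ x. (\<Sum>i. g (i + m) x) * indicator (ccube n L) x \<partial>X)
      \<le> ennreal (2 ^ n * (1 + (2 * L) powr \<sigma>)) * (\<Sum>i. ennreal (w (i + m)))" if L: "0 < L" for L m
  proof -
    have "(\<integral>\<^sup>+ x. (\<Sum>i. g (i + m) x) * indicator (ccube n L) x \<partial>X)
       = (\<integral>\<^sup>+ x. (\<Sum>i. g (i + m) x * indicator (ccube n L) x) \<partial>X)" by simp
    also have "\<dots> = (\<Sum>i. \<integral>\<^sup>+ x. g (i + m) x * indicator (ccube n L) x \<partial>X)"
      by (intro nn_integral_suminf) measurable
    also have "\<dots> \<le> (\<Sum>i. ennreal (2 ^ n * (1 + (2 * L) powr \<sigma>)) * ennreal (w (i + m)))"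
    proof (intro suminf_le)
      fix i
      have "(\<integral>\<^sup>+ x. g (i + m) x * indicator (ccube n L) x \<partial>X)
          \<le> ennreal (local_const L (s (i + m))) * (ennreal (s (i + m) powr \<rho>) * N (g (i + m)))"
        by (rule ccube_integral_le[OF s L gm famD(2)[OF g]])
      also have "\<dots> \<le> ennreal (2 ^ n * (1 + (2 * L) powr \<sigma>)) * ennreal (w (i + m))"
        unfolding w by (intro mult_right_mono ennreal_leI local_const_le[OF s L]) auto
      finally show "(\<integral>\<^sup>+ x. g (i + m) x * indicator (ccube n L) x \<partial>X)
          \<le> ennreal (2 ^ n * (1 + (2 * L) powr \<sigma>)) * ennreal (w (i + m))" .
    qed auto
    finally show ?thesis by simp
  qed
  have "AE x in X. x \<in> ccube n (real (Suc L)) \<longrightarrow> G x \<noteq> top" for L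
  proof -
    \<comment> \<open>The tail estimate with \<open>m = 0\<close> makes \<open>G\<close> integrable
      on every box, hence finite almost everywhere.\<close>
    have "(\<integral>\<^sup>+ x. G x * indicator (ccube n (real (Suc L))) x \<partial>X) \<le> ennreal (2 ^ n * (1 + (2 * real (Suc L)) powr \<sigma>)) * ennreal W"
      unfolding G_def using tail[of "real (Suc L)" 0]
      by (intro order_trans[OF _ mult_left_mono[OF sw]]) simp_all
    also have "\<dots> < top" by (simp add: ennreal_mult_less_top)
    finally have "AE x in X. G x * indicator (ccube n (real (Suc L))) x \<noteq> \<infinity>"
      by (intro nn_integral_PInf_AE) auto
    then show ?thesis by eventually_elim (auto simp: indicator_def)
  qed
  then have "AE x in X. \<forall>L. x \<in> ccube n (real (Suc L)) \<longrightarrow> G x \<noteq> top" by (simp only: AE_all_countable simp_thms)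
  then have G_fin: "AE x in X. G x \<noteq> top"
    using AE_space
  proof eventually_elim
    case (elim x)
    then obtain L :: nat where "0 < L" "x \<in> ccube n (real L)" using space_leb_eq_Union_ccube by blast
    with elim(1) show ?case by (cases L) auto
  qed
  define b where "b i x = f' x * enn2real (g i x) / enn2real (G x) / lam i" for i x
  have pt: "(\<lambda>i. lam i * b i x) sums f' x"
    "ennreal \<bar>b i x\<bar> \<le> ennreal (1 / lam i) * g i x"
    "ennreal \<bar>f' x - (\<Sum>i<m. lam i * b i x)\<bar> \<le> (\<Sum>i. g (i + m) x)"
    if f'x: "ennreal \<bar>f' x\<bar> \<le> G x" and Gx: "G x \<noteq> top" for x i m
  proof -
    define \<Gamma> where "\<Gamma> = enn2real (G x)"
    define \<gamma> where "\<gamma> i = enn2real (g i x)" for i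
    have \<Gamma>: "G x = ennreal \<Gamma>" "0 \<le> \<Gamma>" using Gx by (auto simp: \<Gamma>_def less_top)
    have "g i x < top" for i
      using Gx by (intro ennreal_suminf_lessD[of "\<lambda>i. g i x"]) (simp add: G_def less_top)
    then have \<gamma>: "g i x = ennreal (\<gamma> i)" "0 \<le> \<gamma> i" for i by (auto simp: \<gamma>_def)
    have "(\<lambda>i. ennreal (\<gamma> i)) sums ennreal \<Gamma>"
      using summable_sums[of "\<lambda>i. g i x"] \<Gamma>(1) by (simp add: G_def \<gamma>(1))
    then have sums: "\<gamma> sums \<Gamma>" using \<gamma> \<Gamma> by (simp add: sums_ennreal)
    have f\<Gamma>: "\<bar>f' x\<bar> \<le> \<Gamma>" using f'x \<Gamma> by simp
    \<comment> \<open>If \<open>\<Gamma> = 0\<close>, then \<open>f' x = 0\<close> and division by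
      zero gives \<open>r = 0\<close>, so \<open>r * \<Gamma> = f' x\<close> persists.\<close>
    define r where "r = f' x / \<Gamma>"
    have r: "\<bar>r\<bar> \<le> 1" using f\<Gamma> \<Gamma>(2) by (auto simp: r_def divide_le_eq)
    have r\<Gamma>: "r * \<Gamma> = f' x" using f\<Gamma> by (auto simp: r_def)
    have lb: "lam i * b i x = r * \<gamma> i" for i
      using lam(1)[of i] by (simp add: b_def r_def \<gamma>_def \<Gamma>_def)
    show "(\<lambda>i. lam i * b i x) sums f' x"
      using sums_mult[OF sums, of r] by (simp add: lb r\<Gamma>)
    have "b i x = r * \<gamma> i / lam i" using lb[of i] lam(1)[of i] by (simp add: field_simps)
    then have "\<bar>b i x\<bar> = \<bar>r\<bar> * \<gamma> i / lam i" using \<gamma> lam(1)[of i] by (simp add: abs_mult)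
    also have "\<dots> \<le> 1 * \<gamma> i / lam i"
      using r \<gamma> lam(1)[of i] by (intro divide_right_mono mult_right_mono) auto
    finally have "ennreal \<bar>b i x\<bar> \<le> ennreal (1 / lam i * \<gamma> i)" by (intro ennreal_leI) simp
    also have "\<dots> = ennreal (1 / lam i) * g i x"
      using \<gamma> lam(1)[of i] by (simp only: \<gamma>(1)) (intro ennreal_mult, auto)
    finally show "ennreal \<bar>b i x\<bar> \<le> ennreal (1 / lam i) * g i x" .
    have "f' x - (\<Sum>i<m. lam i * b i x) = r * (\<Gamma> - (\<Sum>i<m. \<gamma> i))"
      by (simp add: lb r\<Gamma> sum_distrib_left right_diff_distrib)
    also have "\<Gamma> - (\<Sum>i<m. \<gamma> i) = (\<Sum>i. \<gamma> (i + m))"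
      using suminf_split_initial_segment[of \<gamma> m] sums by (simp add: sums_iff)
    finally have "\<bar>f' x - (\<Sum>i<m. lam i * b i x)\<bar> = \<bar>r\<bar> * \<bar>\<Sum>i. \<gamma> (i + m)\<bar>" by (simp add: abs_mult)
    also have summ: "summable (\<lambda>i. \<gamma> (i + m))" using sums by (simp add: sums_iff summable_iff_shift)
    then have "\<bar>\<Sum>i. \<gamma> (i + m)\<bar> = (\<Sum>i. \<gamma> (i + m))" using \<gamma> by (simp add: suminf_nonneg)
    also have "\<bar>r\<bar> * (\<Sum>i. \<gamma> (i + m)) \<le> 1 * (\<Sum>i. \<gamma> (i + m))"
      using r \<gamma> summ by (intro mult_right_mono suminf_nonneg) auto
    finally have "ennreal \<bar>f' x - (\<Sum>i<m. lam i * b i x)\<bar> \<le> ennreal (\<Sum>i. \<gamma> (i + m))"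
      by (intro ennreal_leI) simp
    also have "\<dots> = (\<Sum>i. g (i + m) x)"
      using summ \<gamma> by (simp add: suminf_ennreal2)
    finally show "ennreal \<bar>f' x - (\<Sum>i<m. lam i * b i x)\<bar> \<le> (\<Sum>i. g (i + m) x)" .
  qed
  have good: "AE x in X. ennreal \<bar>f' x\<bar> \<le> G x \<and> G x \<noteq> top \<and> f x = f' x"
    using f'g G_fin ff' unfolding G_def by eventually_elim auto
  have bm [measurable]: "b i \<in> borel_measurable X" for i unfolding b_def[abs_def] by measurable
  have "is_block n p0 p (b i)" for i
  proof -
    have "AE x in X. ennreal \<bar>b i x\<bar> \<le> ennreal (1 / lam i) * g i x"
      using good by eventually_elim (blast intro: pt(2))
    then have "N (\<lambda>x. ennreal \<bar>b i x\<bar>) \<le> N (\<lambda>x. ennreal (1 / lam i) * g i x)"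
      by (intro mnorm_mono_AE q_pos)
    also have "\<dots> = ennreal (1 / lam i) * N (g i)"
      by (intro mnorm_cmult q_pos gm)
    also have "N (g i) = ennreal (s i powr (- \<rho>)) * (ennreal (s i powr \<rho>) * N (g i))"
      using s[of i] by (simp flip: mult.assoc ennreal_mult powr_add)
    also have "\<dots> = ennreal (s i powr (- \<rho>)) * ennreal (w i)" by (simp only: w)
    also have "ennreal (1 / lam i) * (ennreal (s i powr (- \<rho>)) * ennreal (w i)) = ennreal (1 / lam i * (s i powr (- \<rho>) * w i))"
      using w0[of i] lam(1)[of i] by (subst ennreal_mult, simp, simp, subst ennreal_mult) simp_all
    also have "\<dots> \<le> ennreal (s i powr (- \<rho>))"
    proof (intro ennreal_leI)
      have "s i powr (- \<rho>) * (w i / lam i) \<le> s i powr (- \<rho>) * 1"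
        using lam[of i] by (intro mult_left_mono) auto
      then show "1 / lam i * (s i powr (- \<rho>) * w i) \<le> s i powr (- \<rho>)" by (simp add: mult.commute)
    qed
    finally have "mixed_norm n (\<lambda>i. conj_exp (p i)) (b i)
        \<le> ennreal ((s i ^ n) powr (1 / p0 - (1 / real n) * (\<Sum>i<n. 1 / p i)))"
      unfolding block_bound_eq[OF s] mixed_norm_eq_mnorm by (simp add: q_def[abs_def])
    moreover have "{x \<in> space (lebn n). b i x \<noteq> 0} \<subseteq> cube n (a i) (s i)"
    proof (unfold space_lebn, safe, rule ccontr)
      fix x assume x: "x \<in> space X" "b i x \<noteq> 0" "x \<notin> cube n (a i) (s i)"
      then show False using famD(2)[OF g x(1,3)] by (simp add: b_def)
    qed
    moreover have "b i \<in> borel_measurable (lebn n)"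
      unfolding lebn_def using bm by (rule measurable_completion)
    ultimately show ?thesis unfolding is_block_def using s by blast
  qed
  moreover have "AE x in lebn n. (\<lambda>m. \<Sum>i<m. lam i * b i x) \<longlonglongrightarrow> f x"
    unfolding AE_lebn using good by eventually_elim (use pt(1) in \<open>auto simp: sums_def\<close>)
  moreover have "(\<lambda>m. \<integral>\<^sup>+ x. ennreal \<bar>f x - (\<Sum>i<m. lam i * b i x)\<bar> * indicator K x \<partial>lebn n) \<longlonglongrightarrow> 0"
    if "compact K \<and> K \<subseteq> space (lebn n)" for K
  proof -
    from compact_subset_ccube[of K n] that obtain L where L: "0 < L" "K \<subseteq> ccube n L" by metis
    let ?C = "ennreal (2 ^ n * (1 + (2 * L) powr \<sigma>))"
    have le: "(\<integral>\<^sup>+ x. ennreal \<bar>f x - (\<Sum>i<m. lam i * b i x)\<bar> * indicator K x \<partial>lebn n)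
        \<le> ?C * (\<Sum>i. ennreal (w (i + m)))" for m
    proof -
      have "(\<integral>\<^sup>+ x. ennreal \<bar>f x - (\<Sum>i<m. lam i * b i x)\<bar> * indicator K x \<partial>lebn n)
          \<le> (\<integral>\<^sup>+ x. (\<Sum>i. g (i + m) x) * indicator (ccube n L) x \<partial>X)"
        unfolding lebn_def nn_integral_completion
      proof (rule nn_integral_mono_AE)
        show "AE x in X. ennreal \<bar>f x - (\<Sum>i<m. lam i * b i x)\<bar> * indicator K x
            \<le> (\<Sum>i. g (i + m) x) * indicator (ccube n L) x"
          using good
        proof eventually_elim
          case (elim x)
          then show ?case using L(2) pt(3)[of x m] by (auto simp: indicator_def)
        qed
      qed
      with tail[OF L(1), of m] show ?thesis by (rule order_trans[rotated])
    qed
    have "(\<lambda>m. ?C * (\<Sum>i. ennreal (w (i + m)))) \<longlonglongrightarrow> 0"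
    proof -
      have "(\<lambda>m. suminf w - (\<Sum>i<m. w i)) \<longlonglongrightarrow> suminf w - suminf w"
        using summ_w by (intro tendsto_diff tendsto_const summable_LIMSEQ)
      then have "(\<lambda>m. \<Sum>i. w (i + m)) \<longlonglongrightarrow> 0"
        using suminf_minus_initial_segment[OF summ_w] by simp
      then have "(\<lambda>m. ?C * ennreal (\<Sum>i. w (i + m))) \<longlonglongrightarrow> ?C * ennreal 0"
        by (intro ennreal_tendsto_cmult tendsto_ennrealI) auto
      moreover have "ennreal (\<Sum>i. w (i + m)) = (\<Sum>i. ennreal (w (i + m)))" for m
        using summ_w w0 by (simp add: suminf_ennreal2 summable_iff_shift)
      ultimately show ?thesis by simp
    qed
    then show ?thesis
      by (rule tendsto_sandwich[OF _ _ tendsto_const, rotated 2]) (use le in auto)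
  qed
  ultimately have "block_decomp n p0 p f lam b"
    using lam_sum(1) lam(1) by (simp add: block_decomp_def less_imp_le)
  moreover have "(\<Sum>i. \<bar>lam i\<bar>) \<le> W + \<epsilon>" using lam_sum(2) lam(1) by (simp add: less_imp_le)
  ultimately show ?thesis by blast
qed

end

section \<open>Midpoints and limits of dominating families\<close>

lemma suminf_liminf_le:
  fixes f :: "nat \<Rightarrow> nat \<Rightarrow> ennreal"
  shows "(\<Sum>i. liminf (\<lambda>m. f m i)) \<le> liminf (\<lambda>m. \<Sum>i. f m i)"
  using nn_integral_liminf[of f "count_space UNIV"] by (simp add: nn_integral_count_space_nat)

lemma ennreal_cmult_liminf_le:
  fixes f :: "nat \<Rightarrow> ennreal"
  shows "c * liminf f \<le> liminf (\<lambda>m. c * f m)"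
  unfolding liminf_SUP_INF SUP_mult_left_ennreal
  by (intro SUP_mono' INF_greatest mult_left_mono INF_lower) auto

lemma ennreal_half_double: "(x + x) / 2 = (x :: ennreal)"
proof (cases x)
  case (real r)
  then show ?thesis by (simp add: divide_ennreal flip: ennreal_plus ennreal_numeral)
qed (simp add: ennreal_top_divide)

context block_exponents
begin

lemma fam_midpoint:
  assumes g: "fam a s W g" and h: "fam a s W h"
  shows "fam a s W (\<lambda>i x. (g i x + h i x) / 2)"
proof -
  note [measurable] = famD(1)[OF g] famD(1)[OF h]
  have "N (\<lambda>x. (g i x + h i x) / 2) \<le> inverse 2 * (N (g i) + N (h i))" for i
  proof -
    have "N (\<lambda>x. (g i x + h i x) / 2) = inverse 2 * N (\<lambda>x. g i x + h i x)"
      unfolding divide_ennreal_def mult.commute[of _ "inverse 2"]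
      by (rule mnorm_cmult[OF q_pos]) measurable
    also have "\<dots> \<le> inverse 2 * (N (g i) + N (h i))"
      by (intro mult_left_mono mnorm_add_le q_ge_1) auto
    finally show ?thesis .
  qed
  then have "(\<Sum>i. ennreal (s i powr \<rho>) * N (\<lambda>x. (g i x + h i x) / 2))
      \<le> (\<Sum>i. ennreal (s i powr \<rho>) * (inverse 2 * (N (g i) + N (h i))))"
    by (intro suminf_le mult_left_mono) auto
  also have "\<dots> = (\<Sum>i. inverse 2 * (ennreal (s i powr \<rho>) * N (g i) + ennreal (s i powr \<rho>) * N (h i)))"
    by (intro suminf_cong) (simp only: mult_ac distrib_left)
  also have "\<dots> = inverse 2 * ((\<Sum>i. ennreal (s i powr \<rho>) * N (g i)) + (\<Sum>i. ennreal (s i powr \<rho>) * N (h i)))"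
    unfolding ennreal_suminf_cmult by (subst suminf_add) auto
  also have "\<dots> \<le> inverse 2 * (W + W)"
    by (intro mult_left_mono add_mono famD(3)[OF g] famD(3)[OF h]) auto
  also have "\<dots> = W"
    using ennreal_half_double[of W] by (simp only: divide_ennreal_def mult.commute)
  finally show ?thesis
    using famD(2)[OF g] famD(2)[OF h] by (simp add: fam_def)
qed

text \<open>The families dominating \<open>\<phi> m\<close> form a decreasing sequence of midpoint-closed sets, so there
  are near-minimal families that converge almost everywhere. Cubes of very small or very large
  side contribute uniformly little to local integrals, and only finitely many of the remaining
  ones meet a given bounded set; hence no mass is lost in the limit.\<close>
lemma fam_limit:
  fixes \<phi> :: "nat \<Rightarrow> (nat \<Rightarrow> real) \<Rightarrow> ennreal"
  assumes s: "\<And>i. 0 < s i"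
    and fin: "\<And>L r R. 0 < r \<Longrightarrow> finite {i. r \<le> s i \<and> s i \<le> R \<and> cube n (a i) (s i) \<inter> ccube n L \<noteq> {}}"
    and \<phi> [measurable]: "\<And>m. \<phi> m \<in> borel_measurable X" and inc: "\<And>m k x. m \<le> k \<Longrightarrow> \<phi> m x \<le> \<phi> k x"
    and \<phi>fin: "AE x in X. (SUP m. \<phi> m x) \<noteq> top" and W: "W \<noteq> top"
    and dom: "\<And>m. \<exists>g. fam a s W g \<and> (AE x in X. \<phi> m x \<le> (\<Sum>i. g i x))"
  shows "\<exists>g. fam a s W g \<and> (AE x in X. (SUP m. \<phi> m x) \<le> (\<Sum>i. g i x))"
proof -
  \<comment> \<open>A whole family is viewed as one function on the product with counting measure,
    so one application of the compactness principle makes all members converge at almost every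
    point.\<close>
  let ?M = "X \<Otimes>\<^sub>M count_space (UNIV :: nat set)"
  define C where "C m = {h \<in> borel_measurable ?M. fam a s W (\<lambda>i x. h (x, i)) \<and>
    (AE x in X. \<phi> m x \<le> (\<Sum>i. h (x, i)))}" for m
  interpret XC: pair_sigma_finite X "count_space (UNIV :: nat set)"
    by (intro pair_sigma_finite.intro sigma_finite_leb sigma_finite_measure_count_space) auto
  have "\<exists>h. (\<forall>m. h m \<in> C m) \<and> (AE z in ?M. \<exists>L. (\<lambda>m. h m z) \<longlonglongrightarrow> L)"
  proof (rule midpoint_closed_AE_convergent)
    show "sigma_finite_measure ?M" by (rule XC.sigma_finite_measure_axioms)
    show "C m \<noteq> {}" for m
    proof -
      obtain g where g: "fam a s W g" "AE x in X. \<phi> m x \<le> (\<Sum>i. g i x)" using dom by blast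
      note [measurable] = famD(1)[OF g(1)]
      have "(\<lambda>(x, i). g i x) \<in> borel_measurable ?M"
        unfolding split_beta'
        by (rule measurable_compose_countable'[where f = "\<lambda>i z. g i (fst z)" and g = snd and I = UNIV]) auto
      then have "(\<lambda>(x, i). g i x) \<in> C m" using g by (simp add: C_def)
      then show ?thesis by blast
    qed
    show "C k \<subseteq> C m" if "m \<le> k" for m k
    proof
      fix h assume h: "h \<in> C k"
      then have "AE x in X. \<phi> k x \<le> (\<Sum>i. h (x, i))" unfolding C_def by blast
      then have "AE x in X. \<phi> m x \<le> (\<Sum>i. h (x, i))"
        by eventually_elim (rule order_trans[OF inc[OF that]])
      with h show "h \<in> C m" unfolding C_def by blast
    qed
    show "h \<in> borel_measurable ?M" if "h \<in> C m" for m h using that by (simp add: C_def)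
    show "(\<lambda>z. (g z + h z) / 2) \<in> C m" if gh: "g \<in> C m" "h \<in> C m" for m g h
    proof -
      have [measurable]: "g \<in> borel_measurable ?M" "h \<in> borel_measurable ?M" using gh by (auto simp: C_def)
      have "AE x in X. \<phi> m x \<le> (\<Sum>i. g (x, i))" "AE x in X. \<phi> m x \<le> (\<Sum>i. h (x, i))"
        using gh unfolding C_def by blast+
      then have "AE x in X. \<phi> m x \<le> (\<Sum>i. (g (x, i) + h (x, i)) / 2)"
      proof eventually_elim
        case (elim x)
        have "\<phi> m x = (\<phi> m x + \<phi> m x) / 2"
          by (rule ennreal_half_double[symmetric])
        also have "\<dots> \<le> ((\<Sum>i. g (x, i)) + (\<Sum>i. h (x, i))) / 2"
          using elim by (intro divide_right_mono_ennreal add_mono)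
        also have "\<dots> = (\<Sum>i. (g (x, i) + h (x, i)) / 2)"
          unfolding ennreal_suminf_divide by (subst suminf_add) auto
        finally show ?case .
      qed
      moreover have "fam a s W (\<lambda>i x. (g (x, i) + h (x, i)) / 2)"
        using gh by (intro fam_midpoint) (auto simp: C_def)
      moreover have "(\<lambda>z. (g z + h z) / 2) \<in> borel_measurable ?M" by measurable
      ultimately show ?thesis unfolding C_def by blast
    qed
  qed
  then obtain h where hC: "\<And>m. h m \<in> C m" and conv: "AE z in ?M. \<exists>L. (\<lambda>m. h m z) \<longlonglongrightarrow> L" by blast
  have hfam: "fam a s W (\<lambda>i x. h m (x, i))" and hdom: "AE x in X. \<phi> m x \<le> (\<Sum>i. h m (x, i))" for m
    using hC[of m] unfolding C_def by blast+
  note hm [measurable] = famD(1)[OF hfam]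
  have off: "h m (x, i) = 0" if "x \<in> space X" "x \<notin> cube n (a i) (s i)" for m i x
    by (rule famD(2)[OF hfam that])
  \<comment> \<open>The lower limit exists everywhere, so it is measurable and vanishes off the
    cubes without exceptional points; almost everywhere it is the limit.\<close>
  define \<beta> where "\<beta> i x = liminf (\<lambda>m. h m (x, i))" for i x
  have \<beta>m [measurable]: "\<beta> i \<in> borel_measurable X" for i unfolding \<beta>_def[abs_def] by measurable
  have lim: "AE x in X. \<forall>i. (\<lambda>m. h m (x, i)) \<longlonglongrightarrow> \<beta> i x"
    using XC.AE_pair[OF conv]
  proof eventually_elim
    case (elim x)
    show ?case
    proof
      fix i
      from elim obtain L where L: "(\<lambda>m. h m (x, i)) \<longlonglongrightarrow> L" by (auto simp: AE_count_space)
      then show "(\<lambda>m. h m (x, i)) \<longlonglongrightarrow> \<beta> i x" using lim_imp_Liminf[OF _ L] by (simp add: \<beta>_def)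
    qed
  qed
  have "(\<Sum>i. ennreal (s i powr \<rho>) * N (\<beta> i)) \<le> (\<Sum>i. liminf (\<lambda>m. ennreal (s i powr \<rho>) * N (\<lambda>x. h m (x, i))))"
  proof (intro suminf_le)
    show "ennreal (s i powr \<rho>) * N (\<beta> i) \<le> liminf (\<lambda>m. ennreal (s i powr \<rho>) * N (\<lambda>x. h m (x, i)))" for i
      unfolding \<beta>_def[abs_def]
      by (rule order_trans[OF mult_left_mono[OF mnorm_liminf_le[OF q_pos hm]] ennreal_cmult_liminf_le]) auto
  qed auto
  also have "\<dots> \<le> liminf (\<lambda>m. \<Sum>i. ennreal (s i powr \<rho>) * N (\<lambda>x. h m (x, i)))" by (rule suminf_liminf_le)
  also have "\<dots> \<le> liminf (\<lambda>m. W)" by (intro Liminf_mono always_eventually allI famD(3)[OF hfam])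
  also have "\<dots> = W" by (simp add: Liminf_const)
  finally have "fam a s W \<beta>"
    using off by (simp add: fam_def \<beta>_def Liminf_const)
  moreover have "AE x in X. (SUP m. \<phi> m x) \<le> (\<Sum>i. \<beta> i x)"
  proof -
    have loc: "AE x in X. x \<in> ccube n L \<longrightarrow> (SUP m. \<phi> m x) \<le> (\<Sum>i. \<beta> i x)" if L: "0 < L" for L
    proof -
      \<comment> \<open>The shortfall of the limit family inside the box. The finiteness in
        \<open>\<phi>fin\<close> is essential here because \<open>top - top = top\<close>.\<close>
      define D where "D x = ((SUP m. \<phi> m x) - (\<Sum>i. \<beta> i x)) * indicator (ccube n L) x" for x
      have [measurable]: "D \<in> borel_measurable X" unfolding D_def[abs_def] by measurable
      have small: "(\<integral>\<^sup>+ x. D x \<partial>X) \<le> ennreal \<eta> * W" if \<eta>: "0 < \<eta>" for \<eta>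
      proof -
        obtain r R where r: "0 < r" and rR: "\<And>s. 0 < s \<Longrightarrow> s < r \<or> R < s \<Longrightarrow> local_const L s \<le> \<eta>"
          using local_const_small[OF L \<eta>] by blast
        \<comment> \<open>Along the finite set \<open>S\<close> sums pass to the limit; every other
          cube either misses the box or has local mass at most \<open>\<eta>\<close> times its
          coefficient.\<close>
        define S where "S = {i. r \<le> s i \<and> s i \<le> R \<and> cube n (a i) (s i) \<inter> ccube n L \<noteq> {}}"
        have S: "finite S" unfolding S_def by (rule fin[OF r])
        define t where "t m x = (\<Sum>i. (if i \<in> S then 0 else h m (x, i)) * indicator (ccube n L) x)" for m x
        have [measurable]: "t m \<in> borel_measurable X" for m unfolding t_def[abs_def] by measurable
        have single: "(\<integral>\<^sup>+ x. (if i \<in> S then 0 else h m (x, i)) * indicator (ccube n L) x \<partial>X)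
            \<le> ennreal \<eta> * (ennreal (s i powr \<rho>) * N (\<lambda>x. h m (x, i)))" for i m
        proof (cases "i \<in> S")
          case True
          then show ?thesis by simp
        next
          case False
          show ?thesis
          proof (cases "cube n (a i) (s i) \<inter> ccube n L = {}")
            case True
            have "(\<integral>\<^sup>+ x. (if i \<in> S then 0 else h m (x, i)) * indicator (ccube n L) x \<partial>X) = (\<integral>\<^sup>+ x. 0 \<partial>X)"
              using True off by (intro nn_integral_cong) (auto simp: indicator_def)
            then show ?thesis by simp
          next
            case ne: False
            then have "s i < r \<or> R < s i" using False by (auto simp: S_def)
            then have "local_const L (s i) \<le> \<eta>" by (rule rR[OF s])
            then have "ennreal (local_const L (s i)) * (ennreal (s i powr \<rho>) * N (\<lambda>x. h m (x, i)))
               \<le> ennreal \<eta> * (ennreal (s i powr \<rho>) * N (\<lambda>x. h m (x, i)))"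
              by (intro mult_right_mono ennreal_leI) auto
            with ccube_integral_le[where g = "\<lambda>x. h m (x, i)" and a = "a i" and s = "s i", OF s L hm off] False show ?thesis
              by (auto intro: order_trans)
          qed
        qed
        have t_int: "(\<integral>\<^sup>+ x. t m x \<partial>X) \<le> ennreal \<eta> * W" for m
        proof -
          have "(\<integral>\<^sup>+ x. t m x \<partial>X) = (\<Sum>i. \<integral>\<^sup>+ x. (if i \<in> S then 0 else h m (x, i)) * indicator (ccube n L) x \<partial>X)"
            unfolding t_def by (intro nn_integral_suminf) measurable
          also have "\<dots> \<le> (\<Sum>i. ennreal \<eta> * (ennreal (s i powr \<rho>) * N (\<lambda>x. h m (x, i))))"
            by (intro suminf_le single) auto
          also have "\<dots> \<le> ennreal \<eta> * W"
            unfolding ennreal_suminf_cmult by (intro mult_left_mono famD(3)[OF hfam]) auto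
          finally show ?thesis .
        qed
        have "AE x in X. D x \<le> liminf (\<lambda>m. t m x)"
        proof -
          have "AE x in X. \<forall>m. \<phi> m x \<le> (\<Sum>i. h m (x, i))" using hdom by (simp only: AE_all_countable simp_thms)
          then show ?thesis using lim \<phi>fin
          proof eventually_elim
            case (elim x)
            let ?B = "\<Sum>i\<in>S. \<beta> i x"
            have B: "?B \<le> (\<Sum>i. \<beta> i x)" by (intro sum_le_suminf S) auto
            \<comment> \<open>If the finite sum is infinite, the limit family already dominates and
              \<open>D x = 0\<close>; otherwise \<open>\<phi> m x\<close> minus the finite sum is
              bounded by the remainder \<open>t m x\<close>, and \<open>m\<close> tends to
              infinity.\<close>
            show ?case
            proof (cases "x \<in> ccube n L \<and> ?B \<noteq> top")
              case True
              have "(\<lambda>m. \<phi> m x) \<longlonglongrightarrow> (SUP m. \<phi> m x)" using inc by (intro LIMSEQ_SUP monoI)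
              moreover have "(\<lambda>m. \<Sum>i\<in>S. h m (x, i)) \<longlonglongrightarrow> ?B" using elim(2) by (intro tendsto_sum) auto
              ultimately have lm: "(\<lambda>m. \<phi> m x - (\<Sum>i\<in>S. h m (x, i))) \<longlonglongrightarrow> (SUP m. \<phi> m x) - ?B"
                using elim(3) True by (intro tendsto_diff_ennreal) auto
              have "\<phi> m x - (\<Sum>i\<in>S. h m (x, i)) \<le> t m x" for m
              proof -
                have "(\<Sum>i. h m (x, i)) = (\<Sum>i. (if i \<in> S then h m (x, i) else 0) + (if i \<in> S then 0 else h m (x, i)))"
                  by (intro suminf_cong) auto
                also have "\<dots> = (\<Sum>i. if i \<in> S then h m (x, i) else 0) + (\<Sum>i. if i \<in> S then 0 else h m (x, i))"
                  by (subst suminf_add) auto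
                also have "(\<Sum>i. if i \<in> S then h m (x, i) else 0) = (\<Sum>i\<in>S. h m (x, i))"
                  using S by (subst suminf_finite[of S]) auto
                also have "(\<Sum>i. if i \<in> S then 0 else h m (x, i)) = t m x"
                  using True by (simp add: t_def)
                finally have "\<phi> m x \<le> (\<Sum>i\<in>S. h m (x, i)) + t m x" using elim(1) by metis
                moreover have "\<phi> m x \<noteq> top"
                  using elim(3) SUP_upper[of m UNIV "\<lambda>m. \<phi> m x"] by (metis UNIV_I top_unique)
                ultimately show ?thesis by (simp add: ennreal_minus_le_iff)
              qed
              then have "liminf (\<lambda>m. \<phi> m x - (\<Sum>i\<in>S. h m (x, i))) \<le> liminf (\<lambda>m. t m x)"
                by (intro Liminf_mono) simp
              then have "(SUP m. \<phi> m x) - ?B \<le> liminf (\<lambda>m. t m x)"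
                using lim_imp_Liminf[OF _ lm] by simp
              moreover have "D x \<le> (SUP m. \<phi> m x) - ?B"
                using B by (auto simp: D_def indicator_def intro!: ennreal_minus_mono)
              ultimately show ?thesis by simp
            next
              case False
              have "D x = 0"
              proof (cases "x \<in> ccube n L")
                case True
                with False B have "(\<Sum>i. \<beta> i x) = top" by (simp add: top_unique)
                then show ?thesis
                  using elim(3) unfolding D_def by (simp only: minus_top_ennreal if_False mult_zero_left)
              qed (simp add: D_def)
              then show ?thesis by simp
            qed
          qed
        qed
        then have "(\<integral>\<^sup>+ x. D x \<partial>X) \<le> (\<integral>\<^sup>+ x. liminf (\<lambda>m. t m x) \<partial>X)" by (rule nn_integral_mono_AE)
        also have "\<dots> \<le> liminf (\<lambda>m. \<integral>\<^sup>+ x. t m x \<partial>X)" by (intro nn_integral_liminf) measurable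
        also have "\<dots> \<le> liminf (\<lambda>m. ennreal \<eta> * W)" by (intro Liminf_mono always_eventually allI t_int)
        also have "\<dots> = ennreal \<eta> * W" by (simp add: Liminf_const)
        finally show ?thesis .
      qed
      obtain W' where W': "W = ennreal W'" "0 \<le> W'" using W by (cases W) auto
      have "(\<integral>\<^sup>+ x. D x \<partial>X) \<le> 0 + ennreal e" if "0 < e" for e
      proof -
        \<comment> \<open>The denominator \<open>W' + 1\<close> also covers
          \<open>W' = 0\<close>.\<close>
        have "(\<integral>\<^sup>+ x. D x \<partial>X) \<le> ennreal (e / (W' + 1)) * ennreal W'"
          using small[of "e / (W' + 1)"] that W' by simp
        also have "\<dots> = ennreal (e / (W' + 1) * W')" using that W' by (intro ennreal_mult[symmetric]) auto
        also have "\<dots> \<le> ennreal e"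
          using that W' by (intro ennreal_leI) (simp add: field_simps)
        finally show ?thesis by simp
      qed
      then have "(\<integral>\<^sup>+ x. D x \<partial>X) \<le> 0" by (rule ennreal_le_epsilon)
      then have "AE x in X. D x = 0" by (simp add: nn_integral_0_iff_AE)
      then show ?thesis
      proof eventually_elim
        case (elim x)
        show ?case
        proof
          assume "x \<in> ccube n L"
          with elim have "(SUP m. \<phi> m x) - (\<Sum>i. \<beta> i x) = 0"
            unfolding D_def by (simp only: indicator_simps mult_1_right)
          then show "(SUP m. \<phi> m x) \<le> (\<Sum>i. \<beta> i x)" by (simp only: diff_eq_0_iff_ennreal)
        qed
      qed
    qed
    have "AE x in X. x \<in> ccube n (real (Suc L)) \<longrightarrow> (SUP m. \<phi> m x) \<le> (\<Sum>i. \<beta> i x)" for L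
      by (rule loc) simp
    then have "AE x in X. \<forall>L. x \<in> ccube n (real (Suc L)) \<longrightarrow> (SUP m. \<phi> m x) \<le> (\<Sum>i. \<beta> i x)"
      by (simp only: AE_all_countable simp_thms)
    then show ?thesis using AE_space
    proof eventually_elim
      case (elim x)
      then obtain L :: nat where "0 < L" "x \<in> ccube n (real L)" using space_leb_eq_Union_ccube by blast
      with elim(1) show ?case by (cases L) auto
    qed
  qed
  ultimately show ?thesis by blast
qed

end

section \<open>The Fatou property\<close>

lemma block_norm_le:
  assumes "block_decomp n p0 p f lam b"
  shows "block_norm n p0 p f \<le> ennreal (\<Sum>i. \<bar>lam i\<bar>)"
  unfolding block_norm_def using assms by (intro INF_lower2[of "(lam, b)"]) auto

lemma block_norm_less_decomp:
  assumes "block_norm n p0 p f < c"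
  shows "\<exists>lam b. block_decomp n p0 p f lam b \<and> ennreal (\<Sum>i. \<bar>lam i\<bar>) < c"
  using assms unfolding block_norm_def INF_less_iff by auto

text \<open>Each block has a Borel version, and the pointwise limit of the resulting partial sums is
  a version of the function.\<close>

lemma block_decomp_ex_borel:
  assumes "block_decomp n p0 p f lam b"
  shows "\<exists>f'\<in>borel_measurable (leb {..<n}). AE x in leb {..<n}. f x = f' x"
proof -
  have "\<exists>b'\<in>borel_measurable (leb {..<n}). AE x in leb {..<n}. b i x = b' x" for i
    using assms by (intro completion_ex_borel_measurable_real) (simp add: block_decomp_def is_block_def lebn_def)
  then obtain b' where b' [measurable]: "\<And>i. b' i \<in> borel_measurable (leb {..<n})"
    and bb': "\<And>i. AE x in leb {..<n}. b i x = b' i x" by metis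
  define f' where "f' x = lim (\<lambda>m. \<Sum>i<m. lam i * b' i x)" for x
  have "f' \<in> borel_measurable (leb {..<n})"
    unfolding f'_def[abs_def] by (intro borel_measurable_lim_metric) measurable
  moreover have "AE x in leb {..<n}. (\<lambda>m. \<Sum>i<m. lam i * b i x) \<longlonglongrightarrow> f x"
    using assms unfolding block_decomp_def AE_lebn by blast
  moreover have "AE x in leb {..<n}. \<forall>i. b i x = b' i x"
    using bb' by (simp only: AE_all_countable simp_thms)
  then have "AE x in leb {..<n}. f x = f' x"
    using \<open>AE x in leb {..<n}. (\<lambda>m. \<Sum>i<m. lam i * b i x) \<longlonglongrightarrow> f x\<close>
    by eventually_elim (simp add: f'_def limI)
  ultimately show ?thesis by blast
qed

context block_exponents
begin

lemma fatou_aux: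
  assumes F: "\<And>k. in_block_space n p0 p (F k)" "\<And>k. block_norm n p0 p (F k) \<le> ennreal A"
    and A: "0 \<le> A" and f' [measurable]: "f' \<in> borel_measurable X" and ff': "AE x in X. f x = f' x"
    and lim: "AE x in X. ennreal \<bar>f x\<bar> \<le> liminf (\<lambda>k. ennreal \<bar>F k x\<bar>)" and \<epsilon>: "0 < \<epsilon>"
  shows "\<exists>lam b. block_decomp n p0 p f lam b \<and> (\<Sum>i. \<bar>lam i\<bar>) \<le> (1 + \<epsilon>) * (A + \<epsilon>) + \<epsilon>"
proof -
  \<comment> \<open>Chosen so that moving blocks to the fixed collection multiplies coefficients by
    exactly \<open>1 + \<epsilon>\<close>.\<close>
  define \<theta> where "\<theta> = (1 + \<epsilon>) powr (1 / \<rho>)"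
  have \<theta>: "1 < \<theta>" using \<epsilon> \<rho>_pos by (simp add: \<theta>_def)
  have \<theta>\<rho>: "\<theta> powr \<rho> = 1 + \<epsilon>" using \<epsilon> \<rho>_pos by (simp add: \<theta>_def powr_powr)
  obtain a and s :: "nat \<Rightarrow> real" where s: "\<And>i. 0 < s i"
    and cover: "\<And>a' l. 0 < l \<Longrightarrow> \<exists>i. s i \<le> \<theta> * l \<and> cube n a' l \<subseteq> cube n (a i) (s i)"
    and fin: "\<And>L r R. 0 < r \<Longrightarrow> finite {i. r \<le> s i \<and> s i \<le> R \<and> cube n (a i) (s i) \<inter> ccube n L \<noteq> {}}"
  proof (rule cube_family[OF \<theta>, of n], goal_cases)
    case (1 a s)
    then show ?thesis by (intro that[of s a])
  qed
  \<comment> \<open>\<open>A + \<epsilon>\<close> comes from a near-optimal decomposition and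
    \<open>1 + \<epsilon>\<close> from changing cubes; the further \<open>\<epsilon>\<close> in the
    conclusion is the padding of the coefficients in \<open>decomp_of_fam\<close>.\<close>
  let ?W = "(1 + \<epsilon>) * (A + \<epsilon>)"
  have W0: "0 \<le> ?W" using A \<epsilon> by simp
  have famF: "\<exists>g. fam a s (ennreal ?W) g \<and> (AE x in X. ennreal \<bar>F k x\<bar> \<le> (\<Sum>i. g i x))" for k
  proof -
    have "block_norm n p0 p (F k) < ennreal (A + \<epsilon>)"
      using F(2)[of k] A \<epsilon> by (intro le_less_trans[OF F(2)[of k]] ennreal_lessI) auto
    then obtain lam b where dec: "block_decomp n p0 p (F k) lam b" and lt: "ennreal (\<Sum>j. \<bar>lam j\<bar>) < ennreal (A + \<epsilon>)"
      using block_norm_less_decomp by blast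
    have "(\<Sum>j. \<bar>lam j\<bar>) \<le> A + \<epsilon>"
      using lt by (metis ennreal_le_iff ennreal_less_zero_iff less_imp_le not_less_zero linorder_not_less ennreal_leI)
    then have le: "ennreal (\<theta> powr \<rho> * (\<Sum>j. \<bar>lam j\<bar>)) \<le> ennreal ?W"
      unfolding \<theta>\<rho> using \<epsilon> by (intro ennreal_leI mult_left_mono) auto
    from fam_of_decomp[OF dec s cover] obtain g where
      g: "fam a s (ennreal (\<theta> powr \<rho> * (\<Sum>j. \<bar>lam j\<bar>))) g" "AE x in X. ennreal \<bar>F k x\<bar> \<le> (\<Sum>i. g i x)" by blast
    from g(1) le have "fam a s (ennreal ?W) g" unfolding fam_def by (blast intro: order_trans)
    with g(2) show ?thesis by blast
  qed
  have "\<exists>F'\<in>borel_measurable X. AE x in X. F k x = F' x" for k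
    using F(1)[of k] block_decomp_ex_borel unfolding in_block_space_def by blast
  then obtain F' where F' [measurable]: "\<And>k. F' k \<in> borel_measurable X" and FF': "\<And>k. AE x in X. F k x = F' k x"
    by metis
  \<comment> \<open>Infima of tails turn the sequence into an increasing one. Capping by
    \<open>\<bar>f' x\<bar>\<close> makes the supremum equal to \<open>\<bar>f x\<bar>\<close>
    almost everywhere, hence finite.\<close>
  define \<phi> where "\<phi> m x = min (ennreal \<bar>f' x\<bar>) (INF k\<in>{m..}. ennreal \<bar>F' k x\<bar>)" for m x
  have [measurable]: "\<phi> m \<in> borel_measurable X" for m
    unfolding \<phi>_def[abs_def] by (intro borel_measurable_min borel_measurable_INF) measurable
  have inc: "\<phi> m x \<le> \<phi> k x" if "m \<le> k" for m k x
    unfolding \<phi>_def using that by (intro min.mono INF_superset_mono) auto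
  have allF: "AE x in X. \<forall>k. F k x = F' k x" using FF' by (simp only: AE_all_countable simp_thms)
  have sup: "AE x in X. (SUP m. \<phi> m x) = ennreal \<bar>f x\<bar>"
    using allF lim ff'
  proof eventually_elim
    case (elim x)
    have "(SUP m. \<phi> m x) = min (ennreal \<bar>f' x\<bar>) (SUP m. INF k\<in>{m..}. ennreal \<bar>F' k x\<bar>)"
    proof (rule antisym)
      show "(SUP m. \<phi> m x) \<le> min (ennreal \<bar>f' x\<bar>) (SUP m. INF k\<in>{m..}. ennreal \<bar>F' k x\<bar>)"
        unfolding \<phi>_def by (intro SUP_least min.mono SUP_upper2[OF UNIV_I]) auto
      show "min (ennreal \<bar>f' x\<bar>) (SUP m. INF k\<in>{m..}. ennreal \<bar>F' k x\<bar>) \<le> (SUP m. \<phi> m x)"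
        unfolding \<phi>_def inf_min[symmetric] inf_SUP by simp
    qed
    also have "\<dots> = ennreal \<bar>f x\<bar>" using elim by (simp add: liminf_SUP_INF min_def)
    finally show ?case .
  qed
  have "\<exists>g. fam a s (ennreal ?W) g \<and> (AE x in X. (SUP m. \<phi> m x) \<le> (\<Sum>i. g i x))"
  proof (rule fam_limit[OF s fin])
    show "AE x in X. (SUP m. \<phi> m x) \<noteq> top" using sup by eventually_elim simp
    show "\<exists>g. fam a s (ennreal ?W) g \<and> (AE x in X. \<phi> m x \<le> (\<Sum>i. g i x))" for m
    proof -
      obtain g where g: "fam a s (ennreal ?W) g" "AE x in X. ennreal \<bar>F m x\<bar> \<le> (\<Sum>i. g i x)" using famF by blast
      have "AE x in X. \<phi> m x \<le> (\<Sum>i. g i x)"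
        using g(2) FF'[of m]
      proof eventually_elim
        case (elim x)
        have "\<phi> m x \<le> ennreal \<bar>F' m x\<bar>"
          unfolding \<phi>_def by (intro min.coboundedI2 INF_lower) auto
        with elim show ?case by simp
      qed
      with g(1) show ?thesis by blast
    qed
  qed (use inc in auto)
  then obtain g where g: "fam a s (ennreal ?W) g" "AE x in X. (SUP m. \<phi> m x) \<le> (\<Sum>i. g i x)" by blast
  have "AE x in X. ennreal \<bar>f' x\<bar> \<le> (\<Sum>i. g i x)"
    using g(2) sup ff' by eventually_elim simp
  from decomp_of_fam[OF s g(1) W0 \<epsilon> f' this ff'] show ?thesis .
qed

text \<open>Applied to a constant sequence, this is the lattice property of the block norm.\<close>
lemma fatou_block_norm:
  assumes F: "\<And>k. in_block_space n p0 p (F k)" "\<And>k. block_norm n p0 p (F k) \<le> ennreal A"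
    and A: "0 \<le> A" and f': "f' \<in> borel_measurable X" "AE x in X. f x = f' x"
    and lim: "AE x in X. ennreal \<bar>f x\<bar> \<le> liminf (\<lambda>k. ennreal \<bar>F k x\<bar>)"
  shows "in_block_space n p0 p f" "block_norm n p0 p f \<le> ennreal A"
proof -
  note aux = fatou_aux[OF F A f' lim]
  show "in_block_space n p0 p f" using aux[of 1] unfolding in_block_space_def by auto
  have le: "block_norm n p0 p f \<le> ennreal ((1 + \<epsilon>) * (A + \<epsilon>) + \<epsilon>)" if "0 < \<epsilon>" for \<epsilon>
    using aux[OF that] block_norm_le by (meson ennreal_leI order_trans)
  show "block_norm n p0 p f \<le> ennreal A"
  proof (rule tendsto_lowerbound)
    have "((\<lambda>\<epsilon>. (1 + \<epsilon>) * (A + \<epsilon>) + \<epsilon>) \<longlongrightarrow> (1 + 0) * (A + 0) + 0) (at_right 0)"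
      by (intro tendsto_intros)
    then show "((\<lambda>\<epsilon>. ennreal ((1 + \<epsilon>) * (A + \<epsilon>) + \<epsilon>)) \<longlongrightarrow> ennreal A) (at_right 0)"
      by (intro tendsto_ennrealI) simp
    show "\<forall>\<^sub>F \<epsilon> in at_right 0. block_norm n p0 p f \<le> ennreal ((1 + \<epsilon>) * (A + \<epsilon>) + \<epsilon>)"
      using eventually_at_right_less by eventually_elim (rule le)
  qed simp
qed

end

theorem theorem4p1:
  fixes n :: nat and p0 :: real and p :: "nat \<Rightarrow> real"
    and fk :: "nat \<Rightarrow> (nat \<Rightarrow> real) \<Rightarrow> real" and f :: "(nat \<Rightarrow> real) \<Rightarrow> real"
  assumes "1 < p0"
    and "\<forall>i<n. 1 < p i"
    and "real n / p0 < (\<Sum>i<n. 1 / p i)"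
    and "\<forall>k. in_block_space n p0 p (fk k)"
    and "\<forall>k. \<forall>x\<in>space (lebn n). 0 \<le> fk k x"
    and "\<forall>k. block_norm n p0 p (fk k) \<le> 1"
    and "AE x in lebn n. incseq (\<lambda>k. fk k x) \<and> (\<lambda>k. fk k x) \<longlonglongrightarrow> f x"
  shows "in_block_space n p0 p f \<and>
         (\<lambda>k. block_norm n p0 p (fk k)) \<longlonglongrightarrow> block_norm n p0 p f"
proof -
  interpret block_exponents n p0 p
    using assms(1,2,3) by unfold_locales auto
  have conv: "AE x in X. incseq (\<lambda>k. fk k x) \<and> (\<lambda>k. fk k x) \<longlonglongrightarrow> f x"
    using assms(7) unfolding AE_lebn .
  have "\<exists>g\<in>borel_measurable X. AE x in X. fk k x = g x" for k
    using assms(4) block_decomp_ex_borel unfolding in_block_space_def by blast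
  then obtain fk' where fk' [measurable]: "\<And>k. fk' k \<in> borel_measurable X"
    and fk_eq: "\<And>k. AE x in X. fk k x = fk' k x" by metis
  define f' where "f' x = lim (\<lambda>k. fk' k x)" for x
  have f': "f' \<in> borel_measurable X"
    unfolding f'_def[abs_def] by (intro borel_measurable_lim_metric) measurable
  have "AE x in X. \<forall>k. fk k x = fk' k x" using fk_eq by (simp only: AE_all_countable simp_thms)
  then have f_eq: "AE x in X. f x = f' x"
    using conv by eventually_elim (auto simp: f'_def limI)
  \<comment> \<open>Using the supremum itself as the bound in the Fatou property, in place of 1,
    gives the sharp upper estimate for the norm of \<open>f\<close>.\<close>
  define S where "S = (SUP k. block_norm n p0 p (fk k))"
  have "S \<le> 1" unfolding S_def using assms(6) by (intro SUP_least) auto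
  then obtain A where A: "S = ennreal A" "0 \<le> A" by (cases S) (auto simp: top_unique)
  have le_A: "block_norm n p0 p (fk k) \<le> ennreal A" for k
    unfolding A(1)[symmetric] S_def by (intro SUP_upper) auto
  have "AE x in X. ennreal \<bar>f x\<bar> \<le> liminf (\<lambda>k. ennreal \<bar>fk k x\<bar>)"
    using conv
  proof eventually_elim
    case (elim x)
    then have "(\<lambda>k. ennreal \<bar>fk k x\<bar>) \<longlonglongrightarrow> ennreal \<bar>f x\<bar>" by (intro tendsto_intros) auto
    from lim_imp_Liminf[OF _ this] show ?case by simp
  qed
  note f = fatou_block_norm[OF assms(4)[rule_format] le_A A(2) f' f_eq this]
  \<comment> \<open>The Fatou property for the constant sequence \<open>F\<close>. Nonnegativity
    turns the one-sided inequality into one between absolute values, and the bound by 1 makes the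
    norm of \<open>F\<close> a real constant.\<close>
  have mono: "block_norm n p0 p (fk k) \<le> block_norm n p0 p F"
    if F: "in_block_space n p0 p F" "block_norm n p0 p F \<le> 1" and le: "AE x in X. fk k x \<le> F x" for k F
  proof -
    obtain B where B: "block_norm n p0 p F = ennreal B" "0 \<le> B"
      using F(2) by (cases "block_norm n p0 p F") (auto simp: top_unique)
    have "AE x in X. ennreal \<bar>fk k x\<bar> \<le> liminf (\<lambda>_::nat. ennreal \<bar>F x\<bar>)"
      using le AE_space
    proof eventually_elim
      case (elim x)
      then have "0 \<le> fk k x" using assms(5) by (simp add: space_lebn)
      with elim show ?case by (simp add: Liminf_const)
    qed
    from fatou_block_norm(2)[OF F(1) _ B(2) fk' fk_eq this] B(1) show ?thesis by simp
  qed
  have "incseq (\<lambda>k. block_norm n p0 p (fk k))"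
  proof (rule incseq_SucI, rule mono)
    show "AE x in X. fk k x \<le> fk (Suc k) x" for k
      using conv by eventually_elim (auto dest: incseq_SucD)
  qed (use assms(4,6) in auto)
  then have "(\<lambda>k. block_norm n p0 p (fk k)) \<longlonglongrightarrow> S" unfolding S_def by (rule LIMSEQ_SUP)
  moreover have "S = block_norm n p0 p f"
  proof (rule antisym)
    show "block_norm n p0 p f \<le> S" using f(2) A(1) by simp
    have "AE x in X. fk k x \<le> f x" for k
      using conv by eventually_elim (auto intro: incseq_le)
    moreover have "block_norm n p0 p f \<le> 1" using f(2) A(1) \<open>S \<le> 1\<close> by (metis order_trans)
    ultimately show "S \<le> block_norm n p0 p f"
      unfolding S_def using f(1) by (intro SUP_least mono)
  qed
  ultimately show ?thesis using f(1) by simp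
qed

end
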